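(* Let $a,b$ be coprime positive integers with $c:=a+b>2$ (i.e. $(a,b)\neq(1,1)$). Then the $\mathbb{Z}$-module $\mathscr{T}(a,b)$ has rank $r:=\omega(abc)-1\ge 1$, and there are $\mathbb{Z}$-linearly independent derivations $\psi_1,\dots,\psi_r\in\mathscr{T}(a,b)$ satisfying $$\prod_{i=1}^r\|\psi_i\|\le \frac{\omega(abc)}{2\log 2}\cdot c\log c.$$
   Context: For a prime $p$, $v_p$ is the $p$-adic valuation. For a non-zero integer $n$, $\mathrm{supp}(n)$ is the set of primes dividing $n$ and $\omega(n)=\#\mathrm{supp}(n)$. Let $\Omega$ be the free $\mathbb{Z}$-module on symbols $\xi_p$, one for each prime $p$. Define $\mathrm{d}:\mathbb{Z}\to\Omega$ by $\mathrm{d}0=0$ and $\mathrm{d}n=\sum_{p\mid n}\frac{n\,v_p(n)}{p}\,\xi_p$ for $n\ne 0$ (the coefficients are integers). For a $\mathbb{Z}$-linear map $\psi:\Omega\to\mathbb{Z}$ put $\|\psi\|=\sup_p|\psi(\xi_p)|$. Let $\mathscr{T}$ be the $\mathbb{Z}$-module of all $\mathbb{Z}$-linear $\psi:\Omega\to\mathbb{Z}$ with $\|\psi\|<\infty$; its elements are called derivations. For $\psi\in\mathscr{T}$ let $\mathrm{d}^\psi=\psi\circ\mathrm{d}:\mathbb{Z}\to\mathbb{Z}$ and $\mathrm{supp}(\psi)=\{p:\psi(\xi_p)\neq0\}$. For positive integers $a,b$, $$\mathscr{T}(a,b)=\{\psi\in\mathscr{T}:\ \mathrm{supp}(\psi)\subseteq\mathrm{supp}(ab(a+b))\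 \text{and}\ \mathrm{d}^\psi(a+b)=\mathrm{d}^\psi a+\mathrm{d}^\psi b\}.$$ *)

theory Defs
  imports
    "HOL-Analysis.Analysis"
    "HOL-Library.Poly_Mapping"
    "HOL-Library.Function_Algebras"
    "HOL-Computational_Algebra.Primes"
begin

typedef prime_number = "{p::nat. prime p}"
  morphisms nat_of_prime prime_of_nat
  by (auto intro: two_is_prime_nat)

definition int_of_prime :: "prime_number \<Rightarrow> int"
  where "int_of_prime p = int (nat_of_prime p)"

lemma prime_int_of_prime: "prime (int_of_prime p)"
  using nat_of_prime[of p] by (simp add: int_of_prime_def)

text \<open>Only used for \<open>n \<noteq> 0\<close>; the set is infinite for \<open>n = 0\<close>.\<close>

definition supp :: "int \<Rightarrow> prime_number set"
  where "supp n = {p. int_of_prime p dvd n}"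

definition omega :: "int \<Rightarrow> nat"
  where "omega n = card (supp n)"

text \<open>
  The free \<open>\<int>\<close>-module on the primes: finitely supported functions with
  scalar multiplication \<^const>\<open>frag_cmul\<close> and basis elements \<^const>\<open>frag_of\<close>.
\<close>

type_synonym Omega = "prime_number \<Rightarrow>\<^sub>0 int"

abbreviation xi :: "prime_number \<Rightarrow> Omega"
  where "xi \<equiv> frag_of"

definition d :: "int \<Rightarrow> Omega"
  where "d n = (if n = 0 then 0 else
    (\<Sum>p\<in>supp n. frag_cmul ((n * int (multiplicity (int_of_prime p) n)) div int_of_prime p) (xi p)))"

text \<open>The integer division in the definition of \<^const>\<open>d\<close> is exact.\<close>

lemma d_coefficient_exact:
  assumes "n \<noteq> 0" "p \<in> supp n"
  shows "int_of_prime p dvd n * int (multiplicity (int_of_prime p) n)"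
  using assms by (simp add: supp_def)

text \<open>Pointwise scalar multiplication; addition of functions is also pointwise.\<close>

definition scale_map :: "int \<Rightarrow> (Omega \<Rightarrow> int) \<Rightarrow> Omega \<Rightarrow> int"
  where "scale_map k \<psi> = (\<lambda>x. k * \<psi> x)"

interpretation map_module: module scale_map
  by standard (auto simp: scale_map_def fun_eq_iff algebra_simps)

definition Z_linear :: "(Omega \<Rightarrow> int) \<Rightarrow> bool"
  where "Z_linear \<psi> \<longleftrightarrow> module_hom frag_cmul (*) \<psi>"

lemma Z_linear_iff:
  "Z_linear \<psi> \<longleftrightarrow> (\<forall>x y. \<psi> (x + y) = \<psi> x + \<psi> y) \<and> (\<forall>k x. \<psi> (frag_cmul k x) = k * \<psi> x)"
proof -
  have "module (frag_cmul :: int \<Rightarrow> Omega \<Rightarrow> Omega)"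
    by standard (simp_all add: frag_cmul_distrib frag_cmul_distrib2)
  moreover have "module ((*) :: int \<Rightarrow> int \<Rightarrow> int)"
    by standard (simp_all add: algebra_simps)
  ultimately show ?thesis
    by (auto simp: Z_linear_def module_hom_def module_hom_axioms_def)
qed

text \<open>Extended real valued, since the supremum over all primes may be infinite.\<close>

definition deriv_norm :: "(Omega \<Rightarrow> int) \<Rightarrow> ereal"
  where "deriv_norm \<psi> = (SUP p. ereal (real_of_int \<bar>\<psi> (xi p)\<bar>))"

definition derivations :: "(Omega \<Rightarrow> int) set"
  where "derivations = {\<psi>. Z_linear \<psi> \<and> deriv_norm \<psi> < \<infinity>}"

definition d_along :: "(Omega \<Rightarrow> int) \<Rightarrow> int \<Rightarrow> int"
  where "d_along \<psi> = \<psi> \<circ> d"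

definition supp_deriv :: "(Omega \<Rightarrow> int) \<Rightarrow> prime_number set"
  where "supp_deriv \<psi> = {p. \<psi> (xi p) \<noteq> 0}"

definition derivations_ab :: "int \<Rightarrow> int \<Rightarrow> (Omega \<Rightarrow> int) set"
  where "derivations_ab a b = {\<psi> \<in> derivations.
    supp_deriv \<psi> \<subseteq> supp (a * b * (a + b)) \<and> d_along \<psi> (a + b) = d_along \<psi> a + d_along \<psi> b}"

text \<open>
  Rank of a submodule: the largest cardinality of a \<open>\<int>\<close>-linearly independent subset.
\<close>

definition has_rank :: "(Omega \<Rightarrow> int) set \<Rightarrow> nat \<Rightarrow> bool"
  where "has_rank M r \<longleftrightarrow>
    (\<exists>B\<subseteq>M. map_module.independent B \<and> finite B \<and> card B = r) \<and>
    (\<forall>B\<subseteq>M. map_module.independent B \<longrightarrow> finite B \<and> card B \<le> r)"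

lemma deriv_norm_finite_iff:
  "deriv_norm \<psi> < \<infinity> \<longleftrightarrow> (\<exists>C. \<forall>p. \<bar>\<psi> (xi p)\<bar> \<le> C)"
proof
  assume fin: "deriv_norm \<psi> < \<infinity>"
  have le: "ereal (real_of_int \<bar>\<psi> (xi p)\<bar>) \<le> deriv_norm \<psi>" for p
    unfolding deriv_norm_def by (rule SUP_upper) simp
  obtain R where "deriv_norm \<psi> = ereal R"
    using fin le[of undefined] by (cases "deriv_norm \<psi>") auto
  with le have R: "real_of_int \<bar>\<psi> (xi p)\<bar> \<le> R" for p
    by (metis ereal_less_eq(3))
  have "\<bar>\<psi> (xi p)\<bar> \<le> \<lfloor>R\<rfloor>" for p
    using R[of p] by (simp only: le_floor_iff)
  then show "\<exists>C. \<forall>p. \<bar>\<psi> (xi p)\<bar> \<le> C"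
    by blast
next
  assume "\<exists>C. \<forall>p. \<bar>\<psi> (xi p)\<bar> \<le> C"
  then obtain C where C: "\<bar>\<psi> (xi p)\<bar> \<le> C" for p
    by blast
  have "deriv_norm \<psi> \<le> ereal (real_of_int C)"
    unfolding deriv_norm_def by (rule SUP_least) (simp only: ereal_less_eq of_int_le_iff C)
  then show "deriv_norm \<psi> < \<infinity>"
    by (rule order.strict_trans1) simp
qed

lemma derivationsI:
  assumes "\<And>x y. \<psi> (x + y) = \<psi> x + \<psi> y" "\<And>k x. \<psi> (frag_cmul k x) = k * \<psi> x"
    and "\<And>p. \<bar>\<psi> (xi p)\<bar> \<le> C"
  shows "\<psi> \<in> derivations"
  using assms unfolding derivations_def Z_linear_iff deriv_norm_finite_iff by blast

lemma derivationsE: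
  assumes "\<psi> \<in> derivations"
  obtains C where "\<And>x y. \<psi> (x + y) = \<psi> x + \<psi> y" "\<And>k x. \<psi> (frag_cmul k x) = k * \<psi> x"
    and "\<And>p. \<bar>\<psi> (xi p)\<bar> \<le> C"
  using assms unfolding derivations_def Z_linear_iff deriv_norm_finite_iff by blast

lemma subspace_derivations: "map_module.subspace derivations"
proof (rule map_module.subspaceI)
  show "0 \<in> derivations"
    by (rule derivationsI[where C = 0]) simp_all
next
  fix \<phi> \<psi> assume "\<phi> \<in> derivations" "\<psi> \<in> derivations"
  then obtain C D where \<phi>: "\<And>x y. \<phi> (x + y) = \<phi> x + \<phi> y"
      "\<And>k x. \<phi> (frag_cmul k x) = k * \<phi> x" "\<And>p. \<bar>\<phi> (xi p)\<bar> \<le> C"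
    and \<psi>: "\<And>x y. \<psi> (x + y) = \<psi> x + \<psi> y"
      "\<And>k x. \<psi> (frag_cmul k x) = k * \<psi> x" "\<And>p. \<bar>\<psi> (xi p)\<bar> \<le> D"
    by (elim derivationsE) blast
  have "\<bar>(\<phi> + \<psi>) (xi p)\<bar> \<le> C + D" for p
    using \<phi>(3)[of p] \<psi>(3)[of p] by simp
  then show "\<phi> + \<psi> \<in> derivations"
    by (intro derivationsI) (simp_all add: \<phi>(1,2) \<psi>(1,2) distrib_left)
next
  fix k \<psi> assume "\<psi> \<in> derivations"
  then obtain C where \<psi>: "\<And>x y. \<psi> (x + y) = \<psi> x + \<psi> y"
      "\<And>k x. \<psi> (frag_cmul k x) = k * \<psi> x" "\<And>p. \<bar>\<psi> (xi p)\<bar> \<le> C"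
    by (elim derivationsE) blast
  have "\<bar>scale_map k \<psi> (xi p)\<bar> \<le> \<bar>k\<bar> * C" for p
    using \<psi>(3)[of p] by (simp add: scale_map_def abs_mult mult_left_mono)
  then show "scale_map k \<psi> \<in> derivations"
    by (intro derivationsI) (simp_all add: scale_map_def \<psi>(1,2) distrib_left)
qed

lemma subspace_derivations_ab: "map_module.subspace (derivations_ab a b)"
proof (rule map_module.subspaceI)
  show "0 \<in> derivations_ab a b"
    by (simp add: derivations_ab_def supp_deriv_def d_along_def
        map_module.subspace_0[OF subspace_derivations])
next
  fix \<phi> \<psi> assume "\<phi> \<in> derivations_ab a b" "\<psi> \<in> derivations_ab a b"
  then have mem: "\<phi> + \<psi> \<in> derivations"
    and sub: "supp_deriv \<phi> \<subseteq> supp (a * b * (a + b))" "supp_deriv \<psi> \<subseteq> supp (a * b * (a + b))"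
    and d: "\<phi> (d (a + b)) = \<phi> (d a) + \<phi> (d b)" "\<psi> (d (a + b)) = \<psi> (d a) + \<psi> (d b)"
    by (simp_all add: derivations_ab_def d_along_def
        map_module.subspace_add[OF subspace_derivations])
  have "supp_deriv (\<phi> + \<psi>) \<subseteq> supp_deriv \<phi> \<union> supp_deriv \<psi>"
    by (auto simp: supp_deriv_def)
  with mem sub d show "\<phi> + \<psi> \<in> derivations_ab a b"
    by (simp add: derivations_ab_def d_along_def) blast
next
  fix k \<psi> assume "\<psi> \<in> derivations_ab a b"
  then have mem: "scale_map k \<psi> \<in> derivations"
    and sub: "supp_deriv \<psi> \<subseteq> supp (a * b * (a + b))"
    and d: "\<psi> (d (a + b)) = \<psi> (d a) + \<psi> (d b)"
    by (simp_all add: derivations_ab_def d_along_def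
        map_module.subspace_scale[OF subspace_derivations])
  have "supp_deriv (scale_map k \<psi>) \<subseteq> supp_deriv \<psi>"
    by (auto simp: supp_deriv_def scale_map_def)
  with sub have "supp_deriv (scale_map k \<psi>) \<subseteq> supp (a * b * (a + b))"
    by blast
  with mem d show "scale_map k \<psi> \<in> derivations_ab a b"
    by (simp add: derivations_ab_def d_along_def scale_map_def distrib_left)
qed

end

theory Submission
  imports Defs
begin

text \<open>
  On the primes dividing \<open>abc\<close> the condition on \<open>\<psi>\<close> is one integral linear equation
  \<open>\<Sum>\<^sub>p e\<^sub>p \<psi>(\<xi>\<^sub>p) = 0\<close> in \<open>n = \<omega>(abc)\<close> unknowns, and coprimality gives
  \<open>\<bar>e\<^sub>p\<bar> = N v\<^sub>p(N) / p \<le> c log c / (2 log 2)\<close> with \<open>N \<in> {a, b, c}\<close>. It therefore suffices to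
  find \<open>n - 1\<close> independent solutions whose sup norms have product at most \<open>\<Sum>\<^sub>p \<bar>e\<^sub>p\<bar>\<close>.

  The successive minima \<open>\<lambda>\<^sub>1 \<le> \<dots> \<le> \<lambda>\<^sub>n\<^sub>-\<^sub>1\<close> of the solution lattice do this, by a discrete form
  of Minkowski's second theorem. Let \<open>h\<^sub>i(k)\<close> be the number of classes of the cube \<open>[0, k)\<^sup>n\<close>
  modulo the saturated span \<open>\<Gamma>\<^sub>i\<close> of the first \<open>i\<close> minimal vectors. Then \<open>h\<^sub>0(k) = k\<^sup>n\<close>;
  \<open>h\<^sub>i(k) / k\<^sup>n\<^sup>-\<^sup>i\<close> is nondecreasing in \<open>k\<close>; and \<open>h\<^sub>i\<^sub>-\<^sub>1(\<lambda>\<^sub>i) = h\<^sub>i(\<lambda>\<^sub>i)\<close>, since a solution of norm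
  below \<open>\<lambda>\<^sub>i\<close> lies in \<open>\<Gamma>\<^sub>i\<^sub>-\<^sub>1\<close>. Hence \<open>h\<^sub>n\<^sub>-\<^sub>1(\<lambda>\<^sub>n\<^sub>-\<^sub>1) \<ge> \<lambda>\<^sub>1 \<cdots> \<lambda>\<^sub>n\<^sub>-\<^sub>1 \<lambda>\<^sub>n\<^sub>-\<^sub>1\<close>. On the other hand
  \<open>h\<^sub>n\<^sub>-\<^sub>1(k)\<close> counts the values of the linear form on the cube, so it is at most
  \<open>k \<Sum>\<^sub>p \<bar>e\<^sub>p\<bar>\<close>.
\<close>

subsection \<open>Integer vectors and coordinate frames\<close>

definition vecs :: "'a set \<Rightarrow> ('a \<Rightarrow> int) set"
  where "vecs I = {x. \<forall>p. p \<notin> I \<longrightarrow> x p = 0}"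

definition dot :: "'a set \<Rightarrow> ('a \<Rightarrow> int) \<Rightarrow> ('a \<Rightarrow> int) \<Rightarrow> int"
  where "dot I a x = (\<Sum>p\<in>I. a p * x p)"

definition cube :: "'a set \<Rightarrow> nat \<Rightarrow> ('a \<Rightarrow> int) set"
  where "cube I k = {x \<in> vecs I. \<forall>p\<in>I. 0 \<le> x p \<and> x p < int k}"

lemma dot_diff: "dot I a (\<lambda>p. x p - y p) = dot I a x - dot I a y"
  by (simp add: dot_def sum_subtractf right_diff_distrib)

lemma dot_scale: "dot I a (\<lambda>p. k * x p) = k * dot I a x"
  by (simp add: dot_def sum_distrib_left algebra_simps)

lemma dot_row_scale: "dot I (\<lambda>p. k * a p) x = k * dot I a x"
  by (simp add: dot_def sum_distrib_left mult_ac)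

lemma dot_row_combination:
  "dot I (\<lambda>p. k * (m * a p - c * a' p)) x = k * (m * dot I a x - c * dot I a' x)"
proof -
  have "dot I (\<lambda>p. k * (m * a p - c * a' p)) x = (\<Sum>p\<in>I. k * (m * (a p * x p) - c * (a' p * x p)))"
    unfolding dot_def by (rule sum.cong) (simp_all add: algebra_simps)
  then show ?thesis
    by (simp only: sum_distrib_left[symmetric] sum_subtractf dot_def)
qed

lemma dot_sum: "dot I a (\<lambda>p. \<Sum>j\<in>J. u j * f j p) = (\<Sum>j\<in>J. u j * dot I a (f j))"
proof -
  have "dot I a (\<lambda>p. \<Sum>j\<in>J. u j * f j p) = (\<Sum>p\<in>I. \<Sum>j\<in>J. u j * (a p * f j p))"
    by (simp add: dot_def sum_distrib_left algebra_simps)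
  also have "\<dots> = (\<Sum>j\<in>J. u j * dot I a (f j))"
    by (subst sum.swap) (simp add: dot_def sum_distrib_left)
  finally show ?thesis .
qed

lemma vecs_cong: "x \<in> vecs I \<Longrightarrow> y \<in> vecs I \<Longrightarrow> (\<And>p. p \<in> I \<Longrightarrow> x p = y p) \<Longrightarrow> x = y"
  by (auto simp: vecs_def fun_eq_iff) metis

lemma cube_bij: "bij_betw (\<lambda>x. restrict x I) (cube I k) (I \<rightarrow>\<^sub>E {0..<int k})"
  by (rule bij_betw_byWitness[where f' = "\<lambda>x p. if p \<in> I then x p else 0"])
    (auto simp: cube_def vecs_def fun_eq_iff PiE_def extensional_def Pi_def)

lemma finite_cube: "finite I \<Longrightarrow> finite (cube I k)"
  using bij_betw_finite[OF cube_bij, of I k] by (simp add: finite_PiE)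

lemma card_cube: "finite I \<Longrightarrow> card (cube I k) = k ^ card I"
  using bij_betw_same_card[OF cube_bij, of I k] by (simp add: card_PiE)

text \<open>
  The vectors \<open>b 0, \<dots>, b (n - 1)\<close> span a sublattice of finite index, and the rows \<open>A j\<close> give
  the coordinates with respect to them, multiplied by the common denominator \<open>M\<close>.
\<close>

locale frame =
  fixes I :: "'a set" and n :: nat and M :: int and b A :: "nat \<Rightarrow> 'a \<Rightarrow> int"
  assumes finite_I: "finite I" and M_pos: "M > 0"
    and b_vecs: "j < n \<Longrightarrow> b j \<in> vecs I"
    and expand: "x \<in> vecs I \<Longrightarrow> p \<in> I \<Longrightarrow> M * x p = (\<Sum>j<n. dot I (A j) x * b j p)"
    and dual: "j < n \<Longrightarrow> l < n \<Longrightarrow> dot I (A j) (b l) = (if j = l then M else 0)"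
begin

definition coords :: "('a \<Rightarrow> int) \<Rightarrow> nat \<Rightarrow> int"
  where "coords x j = (if j < n then dot I (A j) x else 0)"

definition comb :: "(nat \<Rightarrow> int) \<Rightarrow> 'a \<Rightarrow> int"
  where "comb s p = (\<Sum>j<n. s j * b j p)"

text \<open>Divided by \<open>M * t\<close>, the points \<open>comb s\<close> with \<open>s\<close>
  in \<open>cell (M * t * k)\<close> form a fine grid in the cube of side \<open>k\<close>,
  containing each integer point \<open>x\<close> of it as \<open>s = t * coords x\<close>. Inside
  the box the coordinate vectors \<open>s\<close> are arbitrary integer vectors, so coordinates can
  be scaled and rounded separately.\<close>

definition cell :: "int \<Rightarrow> (nat \<Rightarrow> int) set"
  where "cell R = {s \<in> vecs {..<n}. \<forall>p\<in>I. 0 \<le> comb s p \<and> comb s p < R}"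

definition tail :: "nat \<Rightarrow> (nat \<Rightarrow> int) \<Rightarrow> nat \<Rightarrow> int"
  where "tail i s j = (if i \<le> j then s j else 0)"

text \<open>
  Two vectors have the same image iff they differ by an element of the rational span of
  \<open>b 0, \<dots>, b (i - 1)\<close>; so this is the number of points of the cube modulo the saturated
  sublattice of rank \<open>i\<close>.
\<close>

definition classes :: "nat \<Rightarrow> nat \<Rightarrow> nat"
  where "classes i k = card ((\<lambda>x. tail i (coords x)) ` cube I k)"

lemma comb_vecs: "comb s \<in> vecs I"
  using b_vecs by (auto simp: vecs_def comb_def)

lemma coords_vecs: "coords x \<in> vecs {..<n}"
  by (auto simp: vecs_def coords_def)

lemma comb_add: "comb (\<lambda>j. s j + t j) p = comb s p + comb t p"
  by (simp add: comb_def sum.distrib distrib_right)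

lemma comb_diff: "comb (\<lambda>j. s j - t j) p = comb s p - comb t p"
  by (simp add: comb_def sum_subtractf left_diff_distrib)

lemma comb_scale: "comb (\<lambda>j. k * s j) p = k * comb s p"
  by (simp add: comb_def sum_distrib_left algebra_simps)

lemma comb_coords: "x \<in> vecs I \<Longrightarrow> comb (coords x) p = M * x p"
proof (cases "p \<in> I")
  case False
  assume "x \<in> vecs I"
  with False comb_vecs[of "coords x"] show ?thesis
    by (simp add: vecs_def)
qed (simp add: expand comb_def coords_def)

lemma coords_comb: "s \<in> vecs {..<n} \<Longrightarrow> coords (comb s) j = M * s j"
proof (cases "j < n")
  case True
  have "dot I (A j) (comb s) = (\<Sum>l<n. s l * dot I (A j) (b l))"
    using dot_sum[of I "A j" s b "{..<n}"] by (simp add: comb_def[abs_def])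
  also have "\<dots> = (\<Sum>l<n. if l = j then M * s j else 0)"
    by (rule sum.cong) (use True dual in auto)
  finally show ?thesis
    using True by (simp add: coords_def)
qed (auto simp: coords_def vecs_def)

lemma comb_inject:
  assumes "s \<in> vecs {..<n}" "s' \<in> vecs {..<n}" "comb s = comb s'"
  shows "s = s'"
proof
  fix j
  have "M * s j = M * s' j"
    using coords_comb[OF assms(1)] coords_comb[OF assms(2)] assms(3) by metis
  then show "s j = s' j"
    using M_pos by simp
qed

section \<open>Tiling of boxes and counting on the refined grid\<close>

lemma finite_cell: "finite (cell R)"
proof (rule finite_subset)
  show "cell R \<subseteq> (\<lambda>x j. coords x j div M) ` cube I (nat R)"
  proof
    fix s assume s: "s \<in> cell R"
    then have "comb s \<in> cube I (nat R)"
      using comb_vecs by (auto simp: cell_def cube_def)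
    moreover have "s = (\<lambda>j. coords (comb s) j div M)"
      using s coords_comb M_pos by (auto simp: cell_def)
    ultimately show "s \<in> (\<lambda>x j. coords x j div M) ` cube I (nat R)"
      by blast
  qed
qed (simp add: finite_cube finite_I)

text \<open>Division with remainder by \<open>M * t\<close> in each coordinate of
  \<open>comb s\<close>: translates of the small box tile the large one. The translation by
  \<open>M * t * z\<close> stays in the sublattice because \<open>comb (coords z)\<close> is
  \<open>M * z\<close>.\<close>

lemma bij_cell:
  fixes t :: int and k :: nat
  assumes "t > 0"
  shows "bij_betw (\<lambda>(z, w) j. t * coords z j + w j) (cube I k \<times> cell (M * t)) (cell (M * t * int k))"
proof (rule bij_betw_byWitness[where f' = "\<lambda>s. let z = (\<lambda>p. comb s p div (M * t)) in (z, \<lambda>j. s j - t * coords z j)"])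
  have N: "M * t > 0"
    using M_pos assms by simp
  have comb: "comb (\<lambda>j. t * coords z j + w j) p = M * t * z p + comb w p" if "z \<in> vecs I" for z w p
    using that by (simp add: comb_add comb_scale comb_coords)
  have quot: "(\<lambda>p. comb (\<lambda>j. t * coords z j + w j) p div (M * t)) = z"
    if "z \<in> cube I k" "w \<in> cell (M * t)" for z w
  proof (rule vecs_cong)
    show "z \<in> vecs I" using that by (simp add: cube_def)
    show "(\<lambda>p. comb (\<lambda>j. t * coords z j + w j) p div (M * t)) \<in> vecs I"
      using comb_vecs by (auto simp: vecs_def)
    fix p assume "p \<in> I"
    then have "comb w p div (M * t) = 0"
      using that by (auto simp: cell_def)
    then show "comb (\<lambda>j. t * coords z j + w j) p div (M * t) = z p"
      using that N by (subst comb) (auto simp: cube_def div_mult_self4[of "M * t"] simp del: mult_eq_0_iff)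
  qed
  show "\<forall>a\<in>cube I k \<times> cell (M * t).
       (let z = \<lambda>p. comb (case a of (z, w) \<Rightarrow> \<lambda>j. t * coords z j + w j) p div (M * t)
        in (z, \<lambda>j. (case a of (z, w) \<Rightarrow> \<lambda>j. t * coords z j + w j) j - t * coords z j)) = a"
    by (auto simp: quot Let_def)
  show "\<forall>s\<in>cell (M * t * int k).
       (case let z = \<lambda>p. comb s p div (M * t) in (z, \<lambda>j. s j - t * coords z j) of
        (z, w) \<Rightarrow> \<lambda>j. t * coords z j + w j) = s"
    by (auto simp: Let_def)
  show "(\<lambda>(z, w) j. t * coords z j + w j) ` (cube I k \<times> cell (M * t)) \<subseteq> cell (M * t * int k)"
  proof clarify
    fix z w assume z: "z \<in> cube I k" and w: "w \<in> cell (M * t)"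
    have "0 \<le> M * t * z p + comb w p \<and> M * t * z p + comb w p < M * t * int k" if "p \<in> I" for p
    proof -
      have "0 \<le> z p" "z p + 1 \<le> int k" "0 \<le> comb w p" "comb w p < M * t"
        using z w that by (auto simp: cube_def cell_def)
      moreover from this have "M * t * (z p + 1) \<le> M * t * int k" "0 \<le> M * t * z p"
        using N by (auto intro: mult_left_mono)
      ultimately show ?thesis
        by (simp add: algebra_simps)
    qed
    then show "(\<lambda>j. t * coords z j + w j) \<in> cell (M * t * int k)"
      using z w coords_vecs[of z] by (auto simp: cell_def comb cube_def vecs_def)
  qed
  show "(\<lambda>s. let z = \<lambda>p. comb s p div (M * t) in (z, \<lambda>j. s j - t * coords z j)) ` cell (M * t * int k)
    \<subseteq> cube I k \<times> cell (M * t)"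
  proof clarify
    fix s z w assume s: "s \<in> cell (M * t * int k)"
      and "(z, w) = (let z = \<lambda>p. comb s p div (M * t) in (z, \<lambda>j. s j - t * coords z j))"
    then have z: "z = (\<lambda>p. comb s p div (M * t))" and w: "w = (\<lambda>j. s j - t * coords z j)"
      by (auto simp: Let_def)
    have zv: "z \<in> vecs I"
      using comb_vecs[of s] by (auto simp: z vecs_def)
    have "0 \<le> z p \<and> z p < int k" if "p \<in> I" for p
    proof -
      have "0 \<le> comb s p" "comb s p < int k * (M * t)"
        using s that by (auto simp: cell_def mult_ac)
      moreover have "z p * (M * t) \<le> comb s p"
        using N pos_mod_sign[of "M * t" "comb s p"] div_mult_mod_eq[of "comb s p" "M * t"]
        unfolding z by linarith
      ultimately have "z p * (M * t) < int k * (M * t)" "0 \<le> z p"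
        using N by (auto simp: z pos_imp_zdiv_nonneg_iff)
      then show ?thesis
        using N by (auto simp: mult_less_cancel_right)
    qed
    then have "z \<in> cube I k"
      using zv by (auto simp: cube_def)
    moreover have "comb w p = comb s p mod (M * t)" for p
      using zv by (simp add: w comb_diff comb_scale comb_coords)
        (simp add: z minus_div_mult_eq_mod[symmetric] mult_ac)
    then have "w \<in> cell (M * t)"
      using N s coords_vecs[of z] by (auto simp: cell_def vecs_def w)
    ultimately show "z \<in> cube I k \<and> w \<in> cell (M * t)"
      by blast
  qed
qed

lemma card_cell:
  assumes "t > 0"
  shows "card (cell (M * t * int k)) = k ^ card I * card (cell (M * t))"
  using bij_betw_same_card[OF bij_cell[OF assms, of k]]
  by (simp add: card_cartesian_product card_cube finite_I)

text \<open>For \<open>N = M * t\<close> and \<open>i \<le> n\<close>, two points of a cell have the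
  same residue iff \<open>comb\<close> of their difference is \<open>N\<close> times an integer
  vector in the rational span of \<open>b 0, ..., b (i - 1)\<close>: classes of the fine grid modulo
  the saturated sublattice.\<close>

definition residue :: "int \<Rightarrow> nat \<Rightarrow> (nat \<Rightarrow> int) \<Rightarrow> ('a \<Rightarrow> int) \<times> (nat \<Rightarrow> int)"
  where "residue N i s = ((\<lambda>p. comb s p mod N), tail i s)"

text \<open>In the tiling of \<open>bij_cell\<close> the residue determines the offset
  \<open>w\<close> in the small box, then \<open>tail i (coords z)\<close>, and nothing more. So
  counting on the fine grid multiplies \<open>classes i k\<close> by a factor independent of
  \<open>i\<close> and \<open>k\<close>.\<close>

lemma card_residue:
  assumes "t > 0"
  shows "card (residue (M * t) i ` cell (M * t * int k)) = classes i k * card (cell (M * t))"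
proof -
  let ?N = "M * t"
  define T where "T = (\<lambda>x. tail i (coords x)) ` cube I k"
  define G where "G = (\<lambda>(\<tau>, w). (comb w, \<lambda>j::nat. t * \<tau> j + tail i w j))"
  have mod: "comb w p mod ?N = comb w p" if "w \<in> cell ?N" for w p
    using that comb_vecs[of w] by (cases "p \<in> I") (auto simp: cell_def vecs_def)
  have res: "residue ?N i (\<lambda>j. t * coords z j + w j) = G (tail i (coords z), w)"
    if z: "z \<in> cube I k" and w: "w \<in> cell ?N" for z w
  proof -
    have "comb (\<lambda>j. t * coords z j + w j) p mod ?N = comb w p" for p
    proof -
      have "comb (\<lambda>j. t * coords z j + w j) p = comb w p + ?N * z p"
        using z by (simp add: comb_add comb_scale comb_coords cube_def)
      then have "comb (\<lambda>j. t * coords z j + w j) p mod ?N = comb w p mod ?N"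
        by (simp only: mod_mult_self2)
      then show ?thesis
        using mod[OF w] by simp
    qed
    then show ?thesis
      by (auto simp: residue_def G_def tail_def)
  qed
  have "residue ?N i ` cell (?N * int k) = G ` (T \<times> cell ?N)"
    unfolding bij_betw_imp_surj_on[OF bij_cell[OF assms, of k], symmetric] T_def image_image
    using res by (force simp: image_iff)
  moreover have "inj_on G (T \<times> cell ?N)"
  proof (rule inj_onI, clarify)
    fix \<tau> w \<tau>' w' assume "w \<in> cell ?N" "w' \<in> cell ?N" and eq: "G (\<tau>, w) = G (\<tau>', w')"
    then have w: "w = w'"
      by (intro comb_inject) (auto simp: cell_def G_def)
    have "t * \<tau> j + tail i w j = t * \<tau>' j + tail i w' j" for j
      using eq by (auto simp: G_def fun_eq_iff)
    with w assms have "\<tau> j = \<tau>' j" for j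
      by (metis add_right_cancel less_irrefl mult_cancel_left)
    then have "\<tau> = \<tau>'" ..
    with w show "\<tau> = \<tau>' \<and> w = w'" by simp
  qed
  ultimately show ?thesis
    by (simp add: card_image card_cartesian_product T_def classes_def)
qed

subsection \<open>Growth of the number of classes\<close>

definition core :: "int \<Rightarrow> int \<Rightarrow> (nat \<Rightarrow> int) set"
  where "core D R = {s \<in> vecs {..<n}. \<forall>p\<in>I. D \<le> comb s p \<and> comb s p < R - D}"

lemma core_subset_cell: "0 \<le> D \<Longrightarrow> core D R \<subseteq> cell R"
  by (force simp: core_def cell_def)

text \<open>Controls rounding errors: a digit vector displaces a point by an amount independent of
  the box, hence of the refinement of the grid.\<close>

lemma comb_bound:
  assumes "\<And>j. 0 \<le> s j \<and> s j \<le> k" "p \<in> I"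
  shows "\<bar>comb s p\<bar> \<le> k * (\<Sum>j<n. \<Sum>p\<in>I. \<bar>b j p\<bar>)"
proof -
  have "\<bar>comb s p\<bar> \<le> (\<Sum>j<n. \<bar>s j * b j p\<bar>)"
    unfolding comb_def by (rule sum_abs)
  also have "\<dots> \<le> (\<Sum>j<n. k * (\<Sum>p\<in>I. \<bar>b j p\<bar>))"
  proof (rule sum_mono)
    fix j
    have "\<bar>b j p\<bar> \<le> (\<Sum>p\<in>I. \<bar>b j p\<bar>)"
      by (rule member_le_sum) (use assms finite_I in auto)
    then have "\<bar>s j\<bar> * \<bar>b j p\<bar> \<le> k * (\<Sum>p\<in>I. \<bar>b j p\<bar>)"
      using assms(1)[of j] by (intro mult_mono) auto
    then show "\<bar>s j * b j p\<bar> \<le> k * (\<Sum>p\<in>I. \<bar>b j p\<bar>)"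
      by (simp add: abs_mult)
  qed
  finally show ?thesis
    by (simp add: sum_distrib_left)
qed

text \<open>
  A discrete version of scaling by \<open>k' / k\<close> in the last \<open>n - i\<close> coordinates. Every fibre of
  \<open>tail i\<close> is translated as a whole, so that points inequivalent modulo \<open>N\<close> remain so; the
  translation is found by rounding \<open>(k' * f + t) / k\<close> for a chosen point \<open>f\<close> of the fibre and a
  digit vector \<open>t\<close>. The margin \<open>D\<close> absorbs the rounding errors.
\<close>

lemma card_residue_core:
  fixes k k' :: nat and D :: int
  defines "E \<equiv> int k' * (\<Sum>j<n. \<Sum>p\<in>I. \<bar>b j p\<bar>)"
  assumes k: "0 < k" "k \<le> k'" and D: "2 * E \<le> D"
  shows "card (residue N i ` core D (N * int k)) * k' ^ (n - i)
    \<le> card (residue N i ` cell (N * int k')) * k ^ (n - i)"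
proof -
  define X where "X = core D (N * int k)"
  have "E \<ge> 0"
    unfolding E_def by (intro mult_nonneg_nonneg sum_nonneg) auto
  then have fin_X: "finite X"
    unfolding X_def using D by (intro finite_subset[OF core_subset_cell finite_cell]) auto
  \<comment> \<open>One representative of each residue attained on the core.\<close>
  obtain X0 where X0: "X0 \<subseteq> X" "inj_on (residue N i) X0" "residue N i ` X0 = residue N i ` X"
    using subset_image_inj[of "residue N i ` X" "residue N i" X] by auto
  \<comment> \<open>A base point shared by a whole fibre of \<open>tail i\<close>.\<close>
  define f where "f s = inv_into X (tail i) (tail i s)" for s
  have f: "f s \<in> X" "tail i (f s) = tail i s" if "s \<in> X" for s
    using that by (auto simp: f_def inv_into_into f_inv_into_f)
  define J where "J = cube {i..<n} k'"
  define u where "u s t = (\<lambda>j. int k' * f s j + t j)" for s t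
  \<comment> \<open>The shift \<open>u s t div k - f s\<close> is common to the fibre of
    \<open>s\<close>. The remainder \<open>r\<close> is kept so that \<open>u s t\<close> can be
    recovered in the coordinates from \<open>i\<close> on.\<close>
  define z where "z s t = (\<lambda>j. s j - f s j + u s t j div int k)" for s t
  define r where "r s t = tail i (\<lambda>j. u s t j mod int k)" for s t
  \<comment> \<open>Injectivity of \<open>\<Phi>\<close> yields the claim: there are
    \<open>k' ^ (n - i)\<close> digit vectors \<open>t\<close>, and \<open>r\<close> takes at most
    \<open>k ^ (n - i)\<close> values.\<close>
  define \<Phi> where "\<Phi> = (\<lambda>(s, t). (residue N i (z s t), r s t))"
  have J: "0 \<le> t j" "t j < int k'" "tail i t = t" "t \<in> vecs {..<n}" if "t \<in> J" for t j
    using that k by (cases "j \<in> {i..<n}"; auto simp: J_def cube_def vecs_def tail_def fun_eq_iff)+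
  have "inj_on \<Phi> (X0 \<times> J)"
  proof (rule inj_onI, clarify)
    fix s t s' t'
    assume s: "s \<in> X0" "s' \<in> X0" and t: "t \<in> J" "t' \<in> J" and eq: "\<Phi> (s, t) = \<Phi> (s', t')"
    have sX: "s \<in> X" "s' \<in> X"
      using s X0 by auto
    have res: "residue N i (z s t) = residue N i (z s' t')" and r: "r s t = r s' t'"
      using eq by (auto simp: \<Phi>_def)
    have tail_eq: "f s j = f s' j \<and> t j = t' j" if "j \<ge> i" for j
    proof -
      have "tail i (f s) j = tail i s j" "tail i (f s') j = tail i s' j"
        using f sX by auto
      then have "f s j = s j" "f s' j = s' j"
        using that by (auto simp: tail_def)
      moreover have "tail i (z s t) j = tail i (z s' t') j"
        using res by (simp add: residue_def)
      ultimately have div: "u s t j div int k = u s' t' j div int k"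
        using that by (simp add: tail_def z_def)
      have "r s t j = r s' t' j"
        using r by simp
      then have "u s t j mod int k = u s' t' j mod int k"
        using that by (simp add: r_def tail_def)
      with div have u: "u s t j = u s' t' j"
        by (metis div_mult_mod_eq)
      \<comment> \<open>Here \<open>t j\<close> is a base \<open>k'\<close> digit of
        \<open>u s t j\<close>.\<close>
      have "u s t j div int k' = f s j" "u s t j mod int k' = t j"
        using J(1,2)[OF t(1), of j] by (auto simp: u_def)
      moreover have "u s' t' j div int k' = f s' j" "u s' t' j mod int k' = t' j"
        using J(1,2)[OF t(2), of j] by (auto simp: u_def)
      ultimately show ?thesis
        using u by simp
    qed
    have "t j = t' j" for j
    proof -
      have "tail i t j = tail i t' j"
        using tail_eq by (simp add: tail_def)
      then show ?thesis
        using J t by simp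
    qed
    then have tt: "t = t'" by auto
    have "tail i (f s) = tail i (f s')"
      using tail_eq by (auto simp: tail_def)
    then have tails: "tail i s = tail i s'"
      using f sX by simp
    then have ff: "f s = f s'"
      by (simp add: f_def)
    \<comment> \<open>Both points receive the same translation, which cancels modulo
      \<open>N\<close>.\<close>
    have "comb s p mod N = comb s' p mod N" for p
    proof -
      define c where "c = comb (\<lambda>j. u s t j div int k) p - comb (f s) p"
      have "u s' t' = u s t"
        by (simp add: u_def ff tt)
      then have "comb (z s t) p = comb s p + c" "comb (z s' t') p = comb s' p + c"
        by (simp_all add: z_def comb_add comb_diff c_def ff)
      moreover have "comb (z s t) p mod N = comb (z s' t') p mod N"
        using res unfolding residue_def prod.inject by (rule conjunct1[THEN fun_cong])
      ultimately have "(comb s p + c - c) mod N = (comb s' p + c - c) mod N"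
        by (intro mod_diff_cong) simp_all
      then show ?thesis by simp
    qed
    then have "residue N i s = residue N i s'"
      using tails by (simp add: residue_def)
    then show "s = s' \<and> t = t'"
      using X0(2) s tt by (auto dest: inj_onD)
  qed
  moreover have "\<Phi> ` (X0 \<times> J) \<subseteq> residue N i ` cell (N * int k') \<times> cube {i..<n} k"
  proof clarify
    fix s t R rr assume s: "s \<in> X0" and t: "t \<in> J" and eq: "(R, rr) = \<Phi> (s, t)"
    have sX: "s \<in> X" and fX: "f s \<in> X"
      using s X0 f by auto
    have u_vecs: "u s t \<in> vecs {..<n}"
      using J[OF t] fX by (auto simp: u_def vecs_def X_def core_def)
    have "0 \<le> comb (z s t) p \<and> comb (z s t) p < N * int k'" if p: "p \<in> I" for p
    proof -
      let ?m = "\<lambda>j. u s t j mod int k"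
      have "int k * comb (\<lambda>j. u s t j div int k) p = comb (\<lambda>j. u s t j - ?m j) p"
        by (simp flip: comb_scale) (simp add: minus_mod_eq_mult_div)
      also have "\<dots> = int k' * comb (f s) p + comb t p - comb ?m p"
        by (simp add: comb_diff comb_add comb_scale u_def)
      \<comment> \<open>Up to two errors of size at most \<open>E\<close>, this combines the core
        points \<open>s\<close> and \<open>f s\<close> with nonnegative weights \<open>k\<close> and
        \<open>k' - k\<close>. The margin \<open>k' * D \<ge> D \<ge> 2 * E\<close> keeps the result
        inside the box.\<close>
      finally have kz: "int k * comb (z s t) p
          = int k * comb s p + (int k' - int k) * comb (f s) p + comb t p - comb ?m p"
        by (simp add: z_def comb_add comb_diff algebra_simps)
      have bt: "\<bar>comb t p\<bar> \<le> E"
        unfolding E_def using J[OF t] p by (intro comb_bound) (auto simp: less_imp_le)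
      have "?m j \<le> int k'" for j
        using pos_mod_bound[of "int k" "u s t j"] k by linarith
      then have bm: "\<bar>comb ?m p\<bar> \<le> E"
        unfolding E_def using p k by (intro comb_bound) auto
      have lo: "D \<le> comb s p" "D \<le> comb (f s) p"
        and hi: "comb s p \<le> N * int k - D" "comb (f s) p \<le> N * int k - D"
          "comb s p < N * int k - D"
        using sX fX p by (auto simp: X_def core_def less_imp_le)
      have "int k * D \<le> int k * comb s p" "(int k' - int k) * D \<le> (int k' - int k) * comb (f s) p"
        using lo k by (auto intro: mult_left_mono)
      then have "int k' * D \<le> int k * comb s p + (int k' - int k) * comb (f s) p"
        by (simp add: algebra_simps)
      moreover have "int k * comb s p < int k * (N * int k - D)"
        "(int k' - int k) * comb (f s) p \<le> (int k' - int k) * (N * int k - D)"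
        using hi k by (auto intro: mult_left_mono)
      then have "int k * comb s p + (int k' - int k) * comb (f s) p < int k' * (N * int k - D)"
        by (simp add: algebra_simps)
      moreover have "1 * D \<le> int k' * D"
        using k D bt by (intro mult_right_mono) auto
      ultimately have "0 \<le> int k * comb (z s t) p" "int k * comb (z s t) p < int k * (N * int k')"
        using bt bm D unfolding kz by (simp_all add: algebra_simps)
      then show ?thesis
        using k by (simp add: zero_le_mult_iff)
    qed
    moreover have "z s t \<in> vecs {..<n}"
      using sX fX u_vecs by (auto simp: z_def vecs_def X_def core_def)
    ultimately have "z s t \<in> cell (N * int k')"
      by (auto simp: cell_def)
    moreover have "r s t \<in> cube {i..<n} k"
      using k u_vecs by (auto simp: r_def cube_def tail_def vecs_def)
    ultimately show "R \<in> residue N i ` cell (N * int k') \<and> rr \<in> cube {i..<n} k"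
      using eq by (auto simp: \<Phi>_def)
  qed
  ultimately have "card (X0 \<times> J) \<le> card (residue N i ` cell (N * int k') \<times> cube {i..<n} k)"
    by (intro card_inj_on_le[where f = \<Phi>]) (simp_all add: finite_cell finite_cube)
  moreover have "card X0 = card (residue N i ` X)"
    using card_image[OF X0(2)] X0(3) by simp
  ultimately show ?thesis
    by (simp add: card_cartesian_product J_def card_cube X_def)
qed

text \<open>Each point outside the core contributes at most one further residue.\<close>

lemma card_residue_le:
  assumes "0 \<le> D"
  shows "card (residue N i ` cell R) \<le> card (residue N i ` core D R) + (card (cell R) - card (core D R))"
proof -
  have fin: "finite (core D R)"
    using finite_cell core_subset_cell[OF assms] by (rule finite_subset[rotated])
  have "residue N i ` cell R \<subseteq> residue N i ` core D R \<union> residue N i ` (cell R - core D R)"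
    by auto
  then have "card (residue N i ` cell R)
      \<le> card (residue N i ` core D R \<union> residue N i ` (cell R - core D R))"
    by (intro card_mono) (simp_all add: finite_cell fin)
  also have "\<dots> \<le> card (residue N i ` core D R) + card (residue N i ` (cell R - core D R))"
    by (rule card_Un_le)
  also have "\<dots> \<le> card (residue N i ` core D R) + card (cell R - core D R)"
    by (simp add: card_image_le finite_cell)
  finally show ?thesis
    using card_Diff_subset[OF fin core_subset_cell[OF assms]] by simp
qed

text \<open>The coordinate vector \<open>v\<close> of the all-ones vector has
  \<open>comb v = M\<close> on \<open>I\<close>, so translation by \<open>\<delta> * v\<close>
  carries the smaller box into the core.\<close>

lemma card_core_ge:
  assumes "0 \<le> \<delta>"
  shows "card (cell (R - 2 * M * \<delta>)) \<le> card (core (M * \<delta>) R)"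
proof (rule card_inj_on_le)
  define v where "v = coords (\<lambda>p. if p \<in> I then 1 else 0)"
  show "inj_on (\<lambda>s j. s j + \<delta> * v j) (cell (R - 2 * M * \<delta>))"
    by (auto simp: inj_on_def fun_eq_iff)
  have v: "comb v p = M" if "p \<in> I" for p
    unfolding v_def using that by (subst comb_coords) (auto simp: vecs_def)
  have D: "M * \<delta> \<ge> 0"
    using assms M_pos by simp
  show "finite (core (M * \<delta>) R)"
    using finite_cell core_subset_cell[OF D] by (rule finite_subset[rotated])
  have "v \<in> vecs {..<n}"
    by (simp add: v_def coords_vecs)
  then show "(\<lambda>s j. s j + \<delta> * v j) ` cell (R - 2 * M * \<delta>) \<subseteq> core (M * \<delta>) R"
    using D by (auto simp: cell_def core_def comb_add comb_scale v vecs_def mult_ac)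
qed

text \<open>
  The preceding bound loses only a boundary term, which disappears on refining the grid by a
  factor \<open>t\<close> tending to infinity.
\<close>

lemma classes_growth:
  assumes k: "0 < k" "k \<le> k'"
  shows "k' ^ (n - i) * classes i k \<le> k ^ (n - i) * classes i k'"
proof -
  define E where "E = int k' * (\<Sum>j<n. \<Sum>p\<in>I. \<bar>b j p\<bar>)"
  \<comment> \<open>The margin \<open>M * \<delta>\<close> dominates \<open>2 * E\<close> but does
    not depend on \<open>t\<close>, so it becomes negligible against the side
    \<open>M * t * k\<close>.\<close>
  define \<delta> where "\<delta> = nat (2 * E)"
  define m where "m = card I"
  define \<sigma> where "\<sigma> = card (cell M)"
  have E: "E \<ge> 0"
    unfolding E_def by (intro mult_nonneg_nonneg sum_nonneg) auto
  have "1 * (2 * E) \<le> M * (2 * E)"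
    using E M_pos by (intro mult_right_mono) auto
  then have D: "2 * E \<le> M * int \<delta>"
    using E by (simp add: \<delta>_def)
  have "(\<lambda>j. 0) \<in> cell M"
    using M_pos by (simp add: cell_def vecs_def comb_def)
  then have \<sigma>: "\<sigma> > 0"
    using finite_cell by (auto simp: \<sigma>_def card_gt_0_iff)
  have card_cellM: "card (cell (M * int l)) = l ^ m * \<sigma>" for l
    using card_cell[of 1 l] by (simp add: m_def \<sigma>_def)
  \<comment> \<open>After division by \<open>t ^ m * \<sigma>\<close>, the size of
    \<open>cell (M * t)\<close>, the inequality holds up to the boundary term
    \<open>k ^ m - (k - 2 * \<delta> / t) ^ m\<close>.\<close>
  have bound: "real k' ^ (n - i) * (real (classes i k) - real k ^ m + (real k - 2 * real \<delta> / real t) ^ m)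
      \<le> real k ^ (n - i) * real (classes i k')" if t: "t > 0" "2 * \<delta> \<le> t * k" for t
  proof -
    define inn where "inn = card (residue (M * int t) i ` core (M * int \<delta>) (M * int t * int k))"
    have cell_k: "card (cell (M * int t * int l)) = (t * l) ^ m * \<sigma>" for l
      using card_cellM[of "t * l"] by (simp add: mult_ac)
    have "M * int t * int k - 2 * M * int \<delta> = M * int (t * k - 2 * \<delta>)"
      using t(2) by (simp add: of_nat_diff right_diff_distrib mult_ac)
    then have ge: "(t * k - 2 * \<delta>) ^ m * \<sigma> \<le> card (core (M * int \<delta>) (M * int t * int k))"
      using card_core_ge[of "int \<delta>" "M * int t * int k"] card_cellM[of "t * k - 2 * \<delta>"] by simp
    have "classes i k * (t ^ m * \<sigma>) \<le> inn + ((t * k) ^ m * \<sigma> - (t * k - 2 * \<delta>) ^ m * \<sigma>)"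
      using card_residue_le[of "M * int \<delta>" "M * int t" i "M * int t * int k"]
        card_residue[of "int t" i k] t(1) ge cell_k[of k] card_cellM[of t] D E
      by (simp add: inn_def)
    \<comment> \<open>Allows the truncated subtraction to be replaced by an addition.\<close>
    moreover have "(t * k - 2 * \<delta>) ^ m * \<sigma> \<le> (t * k) ^ m * \<sigma>"
      by (intro mult_right_mono power_mono) auto
    ultimately have "classes i k * (t ^ m * \<sigma>) + (t * k - 2 * \<delta>) ^ m * \<sigma> \<le> inn + (t * k) ^ m * \<sigma>"
      by linarith
    moreover have inn: "inn * k' ^ (n - i) \<le> classes i k' * (t ^ m * \<sigma>) * k ^ (n - i)"
      using card_residue_core[of k k' "M * int \<delta>" "M * int t" i] k D t(1)
        card_residue[of "int t" i k'] card_cellM[of t]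
      by (simp add: inn_def E_def)
    ultimately have "(classes i k * (t ^ m * \<sigma>) + (t * k - 2 * \<delta>) ^ m * \<sigma>) * k' ^ (n - i)
        \<le> (inn + (t * k) ^ m * \<sigma>) * k' ^ (n - i)"
      by (intro mult_right_mono) auto
    with inn have "(classes i k * (t ^ m * \<sigma>) + (t * k - 2 * \<delta>) ^ m * \<sigma>) * k' ^ (n - i)
        \<le> classes i k' * (t ^ m * \<sigma>) * k ^ (n - i) + (t * k) ^ m * \<sigma> * k' ^ (n - i)"
      unfolding add_mult_distrib[of inn] by linarith
    then have "real ((classes i k * (t ^ m * \<sigma>) + (t * k - 2 * \<delta>) ^ m * \<sigma>) * k' ^ (n - i))
        \<le> real (classes i k' * (t ^ m * \<sigma>) * k ^ (n - i) + (t * k) ^ m * \<sigma> * k' ^ (n - i))"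
      by (simp only: of_nat_le_iff)
    moreover have "real (t * k - 2 * \<delta>) = real t * (real k - 2 * real \<delta> / real t)"
      using t by (simp add: of_nat_diff field_simps)
    then have "real ((t * k - 2 * \<delta>) ^ m) = real t ^ m * (real k - 2 * real \<delta> / real t) ^ m"
      by (simp only: of_nat_power power_mult_distrib)
    ultimately have "(real (classes i k) * (real t ^ m * real \<sigma>)
          + real t ^ m * (real k - 2 * real \<delta> / real t) ^ m * real \<sigma>) * real k' ^ (n - i)
        \<le> real (classes i k') * (real t ^ m * real \<sigma>) * real k ^ (n - i)
          + (real t * real k) ^ m * real \<sigma> * real k' ^ (n - i)"
      by (simp only: of_nat_add of_nat_mult of_nat_power)
    then have "(real t ^ m * real \<sigma>) * (real k' ^ (n - i) * (real (classes i k) - real k ^ m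
          + (real k - 2 * real \<delta> / real t) ^ m))
        \<le> (real t ^ m * real \<sigma>) * (real k ^ (n - i) * real (classes i k'))"
      unfolding power_mult_distrib by argo
    then show ?thesis
      using t \<sigma> by (subst (asm) mult_le_cancel_left_pos) auto
  qed
  have "(\<lambda>t. real k' ^ (n - i) * (real (classes i k) - real k ^ m + (real k - 2 * real \<delta> / real t) ^ m))
      \<longlonglongrightarrow> real k' ^ (n - i) * (real (classes i k) - real k ^ m + (real k - 0) ^ m)"
    by (intro tendsto_intros lim_const_over_n)
  moreover have "\<forall>\<^sub>F t in sequentially. real k' ^ (n - i) * (real (classes i k) - real k ^ m
      + (real k - 2 * real \<delta> / real t) ^ m) \<le> real k ^ (n - i) * real (classes i k')"
  proof (rule eventually_sequentiallyI[of "2 * \<delta> + 1"])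
    fix t assume "2 * \<delta> + 1 \<le> t"
    moreover from this have "t * 1 \<le> t * k"
      using k by (intro mult_le_mono) auto
    ultimately have "t > 0" "2 * \<delta> \<le> t * k"
      by linarith+
    then show "real k' ^ (n - i) * (real (classes i k) - real k ^ m
      + (real k - 2 * real \<delta> / real t) ^ m) \<le> real k ^ (n - i) * real (classes i k')"
      by (rule bound)
  qed
  ultimately have "real k' ^ (n - i) * (real (classes i k) - real k ^ m + (real k - 0) ^ m)
      \<le> real k ^ (n - i) * real (classes i k')"
    by (rule tendsto_upperbound) simp
  then have "real (k' ^ (n - i) * classes i k) \<le> real (k ^ (n - i) * classes i k')"
    by simp
  then show ?thesis
    by (simp only: of_nat_le_iff)
qed

end

subsection \<open>Pivoting and successive minima\<close>

text \<open>The standard basis is its own dual with denominator 1; all exchanges start from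
  it.\<close>

lemma frame_unit:
  assumes "finite I"
  shows "\<exists>b A. frame I (card I) 1 b A"
proof -
  obtain h where h: "bij_betw h {..<card I} I"
    using ex_bij_betw_nat_finite[OF assms] by (auto simp: atLeast0LessThan)
  define b :: "nat \<Rightarrow> 'a \<Rightarrow> int" where "b = (\<lambda>j p. if p = h j then 1 else 0)"
  have hI: "h j \<in> I" if "j < card I" for j
    using h that by (auto simp: bij_betw_def)
  have dot_b: "dot I (b j) x = x (h j)" if "j < card I" for j x
  proof -
    have "dot I (b j) x = (\<Sum>p\<in>I. if p = h j then x p else 0)"
      unfolding dot_def b_def by (rule sum.cong) auto
    then show ?thesis
      using assms hI[OF that] by simp
  qed
  have "frame I (card I) 1 b b"
  proof
    show "b j \<in> vecs I" if "j < card I" for j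
      using hI[OF that] by (auto simp: b_def vecs_def)
    show "1 * x p = (\<Sum>j<card I. dot I (b j) x * b j p)" if "p \<in> I" for x p
    proof -
      have "(\<Sum>j<card I. dot I (b j) x * b j p) = (\<Sum>j<card I. x (h j) * (if p = h j then 1 else 0))"
        by (rule sum.cong) (simp_all only: dot_b lessThan_iff, simp add: b_def)
      also have "\<dots> = (\<Sum>q\<in>I. x q * (if p = q then 1 else 0))"
        using h by (rule sum.reindex_bij_betw)
      also have "\<dots> = (\<Sum>q\<in>I. if p = q then x q else 0)"
        by (rule sum.cong) auto
      also have "\<dots> = x p"
        using assms that by simp
      finally show ?thesis by simp
    qed
    show "dot I (b j) (b l) = (if j = l then 1 else 0)" if "j < card I" "l < card I" for j l
    proof -
      have "h j = h l \<longleftrightarrow> j = l"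
        using h that by (auto simp: bij_betw_def inj_on_def)
      then show ?thesis
        unfolding dot_b[OF that(1)] by (simp add: b_def)
    qed
  qed (use assms in auto)
  then show ?thesis by blast
qed

lemma frame_swap:
  assumes "frame I n M b A" and "i < n" "l < n"
  shows "frame I n M (\<lambda>j. b (Transposition.transpose i l j)) (\<lambda>j. A (Transposition.transpose i l j))"
proof -
  interpret frame I n M b A by fact
  have bij: "bij_betw (Transposition.transpose i l) {..<n} {..<n}"
    by (rule bij_betw_byWitness[where f' = "Transposition.transpose i l"])
      (use assms in \<open>auto simp: Transposition.transpose_def\<close>)
  have less: "Transposition.transpose i l j < n" if "j < n" for j
    using assms that by (simp add: Transposition.transpose_def)
  show ?thesis
  proof
    show "M * x p = (\<Sum>j<n. dot I (A (Transposition.transpose i l j)) x * b (Transposition.transpose i l j) p)"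
      if "x \<in> vecs I" "p \<in> I" for x p
      using expand[OF that] sum.reindex_bij_betw[OF bij, of "\<lambda>j. dot I (A j) x * b j p"] by simp
    show "dot I (A (Transposition.transpose i l j)) (b (Transposition.transpose i l k)) = (if j = k then M else 0)"
      if "j < n" "k < n" for j k
    proof -
      have "Transposition.transpose i l j = Transposition.transpose i l k \<longleftrightarrow> j = k"
        using inj_transpose[of i l] by (rule inj_eq)
      then show ?thesis
        by (simp only: dual[OF less less, OF that])
    qed
  qed (use less b_vecs finite_I M_pos in auto)
qed

text \<open>Steinitz exchange of \<open>b i\<close> for \<open>v\<close>: the expansion of
  \<open>v\<close> is solved for \<open>b i\<close> and substituted into that of \<open>x\<close>.
  The factor \<open>\<bar>m\<bar>\<close> clears the new denominator, and \<open>sgn m\<close> keeps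
  it positive.\<close>

lemma frame_pivot:
  assumes "frame I n M b A" and i: "i < n" and v: "v \<in> vecs I" and nz: "dot I (A i) v \<noteq> 0"
  defines "m \<equiv> dot I (A i) v"
  shows "frame I n (\<bar>m\<bar> * M) (b(i := v))
    (\<lambda>j p. if j = i then sgn m * M * A i p else sgn m * (m * A j p - dot I (A j) v * A i p))"
    (is "frame I n _ _ ?A")
proof -
  interpret frame I n M b A by fact
  have A_i: "dot I (?A i) x = sgn m * M * dot I (A i) x" for x
    by (simp add: dot_row_scale)
  have A_j: "dot I (?A j) x = sgn m * (m * dot I (A j) x - dot I (A j) v * dot I (A i) x)"
    if "j \<noteq> i" for j x
    using that by (simp add: dot_row_combination)
  show ?thesis
  proof
    show "0 < \<bar>m\<bar> * M"
      using nz M_pos by (simp add: m_def)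
    show "(b(i := v)) j \<in> vecs I" if "j < n" for j
      using that b_vecs v by simp
    show "\<bar>m\<bar> * M * x p = (\<Sum>j<n. dot I (?A j) x * (b(i := v)) j p)"
      if x: "x \<in> vecs I" and p: "p \<in> I" for x p
    proof -
      have split: "(\<Sum>j<n. g j) = g i + (\<Sum>j\<in>{..<n} - {i}. g j)" for g :: "nat \<Rightarrow> int"
        using i by (simp add: sum.remove)
      have x': "(\<Sum>j\<in>{..<n} - {i}. dot I (A j) x * b j p) = M * x p - dot I (A i) x * b i p"
        using expand[OF x p] by (simp add: split)
      have v': "(\<Sum>j\<in>{..<n} - {i}. dot I (A j) v * b j p) = M * v p - m * b i p"
        using expand[OF v p] by (simp add: split m_def)
      have "(\<Sum>j\<in>{..<n} - {i}. dot I (?A j) x * (b(i := v)) j p)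
          = (\<Sum>j\<in>{..<n} - {i}. sgn m * (m * (dot I (A j) x * b j p)
              - dot I (A i) x * (dot I (A j) v * b j p)))"
      proof (rule sum.cong[OF refl])
        fix j assume "j \<in> {..<n} - {i}"
        then have "j \<noteq> i" by simp
        then show "dot I (?A j) x * (b(i := v)) j p = sgn m * (m * (dot I (A j) x * b j p)
              - dot I (A i) x * (dot I (A j) v * b j p))"
          unfolding A_j[OF \<open>j \<noteq> i\<close>] by (simp add: algebra_simps)
      qed
      also have "\<dots> = sgn m * (m * (M * x p - dot I (A i) x * b i p)
          - dot I (A i) x * (M * v p - m * b i p))"
        by (simp only: sum_distrib_left[symmetric] sum_subtractf x' v')
      also have "\<dots> = sgn m * m * M * x p - sgn m * M * dot I (A i) x * v p"
        by (simp add: algebra_simps)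
      finally show ?thesis
        unfolding split[of "\<lambda>j. dot I (?A j) x * (b(i := v)) j p"] A_i
        by (simp add: abs_sgn mult_ac)
    qed
    show "dot I (?A j) ((b(i := v)) l) = (if j = l then \<bar>m\<bar> * M else 0)"
      if "j < n" "l < n" for j l
    proof (cases "j = i")
      case True
      show ?thesis
        unfolding True A_i using that i by (auto simp: dual abs_sgn m_def)
    next
      case False
      show ?thesis
        unfolding A_j[OF False] using that i False by (auto simp: dual abs_sgn m_def)
    qed
  qed (rule finite_I)
qed

text \<open>
  Besides inserting \<open>v\<close> at position \<open>i\<close>, the new frame must keep the spans of the first \<open>j\<close>
  vectors for \<open>j \<le> i\<close>; this is what the last conjunct says.
\<close>

lemma frame_extend:
  assumes fr: "frame I n M b A" and il: "i \<le> l" "l < n" and v: "v \<in> vecs I" "dot I (A l) v \<noteq> 0"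
  shows "\<exists>M' b' A'. frame I n M' b' A' \<and> (\<forall>j<i. b' j = b j) \<and> b' i = v \<and>
    (\<forall>j\<le>i. \<forall>x. (\<forall>k. j \<le> k \<and> k < n \<longrightarrow> dot I (A k) x = 0)
      \<longrightarrow> (\<forall>k. j \<le> k \<and> k < n \<longrightarrow> dot I (A' k) x = 0))"
proof -
  define b1 where "b1 j = b (Transposition.transpose i l j)" for j
  define A1 where "A1 j = A (Transposition.transpose i l j)" for j
  have fr1: "frame I n M b1 A1"
    unfolding b1_def A1_def using frame_swap[OF fr] il by simp
  have nz: "dot I (A1 i) v \<noteq> 0"
    using v by (simp add: A1_def)
  define A2 where "A2 = (\<lambda>j p. if j = i then sgn (dot I (A1 i) v) * M * A1 i p
    else sgn (dot I (A1 i) v) * (dot I (A1 i) v * A1 j p - dot I (A1 j) v * A1 i p))"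
  have "frame I n (\<bar>dot I (A1 i) v\<bar> * M) (b1(i := v)) A2"
    unfolding A2_def using frame_pivot[OF fr1 _ v(1) nz] il by simp
  moreover have "\<forall>j<i. (b1(i := v)) j = b j" "(b1(i := v)) i = v"
    using il by (auto simp: b1_def Transposition.transpose_def)
  moreover have "dot I (A2 k) x = 0"
    if ji: "j \<le> i" and z: "\<forall>k. j \<le> k \<and> k < n \<longrightarrow> dot I (A k) x = 0" and k: "j \<le> k" "k < n"
    for j k x
  proof -
    \<comment> \<open>Both \<open>i\<close> and \<open>l\<close> are at least \<open>j\<close>, so
      the transposition permutes the rows of index at least \<open>j\<close> among themselves. Row
      \<open>k\<close> of \<open>A2\<close> combines rows \<open>k\<close> and \<open>i\<close> of
      \<open>A1\<close>.\<close>
    have "dot I (A1 k) x = 0" "dot I (A1 i) x = 0"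
      using z k ji il by (auto simp: A1_def Transposition.transpose_def)
    then show ?thesis
      by (cases "k = i") (simp add: A2_def dot_row_scale, simp add: A2_def dot_row_combination)
  qed
  ultimately show ?thesis by blast
qed

context frame
begin

lemma dot_expand:
  assumes "x \<in> vecs I"
  shows "M * dot I e x = (\<Sum>j<n. dot I (A j) x * dot I e (b j))"
proof -
  have "M * dot I e x = dot I e (\<lambda>p. M * x p)"
    by (rule dot_scale[symmetric])
  also have "\<dots> = dot I e (\<lambda>p. \<Sum>j<n. dot I (A j) x * b j p)"
    unfolding dot_def[of I e] using expand[OF assms] by (intro sum.cong) auto
  finally show ?thesis
    by (simp only: dot_sum)
qed

text \<open>The \<open>b j\<close> span a sublattice of finite index, so a form vanishing on all of
  them would vanish on the unit vector at \<open>p\<close>.\<close>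

lemma kernel_proper:
  assumes "p \<in> I" "e p \<noteq> 0"
  shows "\<exists>j<n. dot I e (b j) \<noteq> 0"
proof (rule ccontr)
  define x :: "'a \<Rightarrow> int" where "x = (\<lambda>q. if q = p then 1 else 0)"
  assume "\<not> (\<exists>j<n. dot I e (b j) \<noteq> 0)"
  moreover have "x \<in> vecs I"
    using assms by (auto simp: x_def vecs_def)
  ultimately have "M * dot I e x = 0"
    by (simp add: dot_expand)
  moreover have "dot I e x = (\<Sum>q\<in>I. if q = p then e p else 0)"
    unfolding dot_def x_def by (rule sum.cong) auto
  ultimately show False
    using assms M_pos finite_I by simp
qed

end

section \<open>Successive minima of the kernel\<close>

definition supnorm :: "'a set \<Rightarrow> ('a \<Rightarrow> int) \<Rightarrow> nat"
  where "supnorm I x = Max ((\<lambda>p. nat \<bar>x p\<bar>) ` I)"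

lemma supnorm_ge: "finite I \<Longrightarrow> x \<in> vecs I \<Longrightarrow> \<bar>x p\<bar> \<le> int (supnorm I x)"
proof (cases "p \<in> I")
  case True
  assume "finite I"
  with True have "nat \<bar>x p\<bar> \<le> supnorm I x"
    unfolding supnorm_def by (intro Max_ge) auto
  then show ?thesis by linarith
qed (simp add: vecs_def)

lemma supnorm_less:
  assumes "finite I" "I \<noteq> {}" "\<And>p. p \<in> I \<Longrightarrow> \<bar>x p\<bar> < int k"
  shows "supnorm I x < k"
  unfolding supnorm_def using assms by (subst Max_less_iff) (auto simp: nat_less_iff)

text \<open>
  The first \<open>i\<close> vectors of the frame realise successive minima of the kernel of \<open>e\<close>: a kernel
  vector shorter than \<open>b j\<close> lies in the rational span of \<open>b 0, \<dots>, b (j - 1)\<close>.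
\<close>

definition successive :: "'a set \<Rightarrow> ('a \<Rightarrow> int) \<Rightarrow> nat \<Rightarrow> (nat \<Rightarrow> 'a \<Rightarrow> int) \<Rightarrow> (nat \<Rightarrow> 'a \<Rightarrow> int) \<Rightarrow> nat \<Rightarrow> bool"
  where "successive I e n b A i \<longleftrightarrow> (\<forall>j<i. dot I e (b j) = 0 \<and>
    (\<forall>x\<in>vecs I. dot I e x = 0 \<and> supnorm I x < supnorm I (b j)
      \<longrightarrow> (\<forall>l. j \<le> l \<and> l < n \<longrightarrow> dot I (A l) x = 0)))"

text \<open>Greedy choice: a shortest kernel vector outside the rational span of the first
  \<open>i\<close> vectors is inserted at position \<open>i\<close>, and \<open>frame_extend\<close>
  preserves the minimality of the earlier ones.\<close>

lemma exists_successive: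
  assumes "finite I" "i < card I"
  shows "\<exists>M b A. frame I (card I) M b A \<and> successive I e (card I) b A i"
  using assms(2)
proof (induction i)
  case 0
  then show ?case
    using frame_unit[OF assms(1)] by (auto simp: successive_def)
next
  case (Suc i)
  let ?n = "card I"
  from Suc obtain M b A where fr: "frame I ?n M b A" and succ: "successive I e ?n b A i"
    by auto
  interpret frame I ?n M b A by fact
  define P where "P v \<longleftrightarrow> v \<in> vecs I \<and> dot I e v = 0 \<and> (\<exists>l. i \<le> l \<and> l < ?n \<and> dot I (A l) v \<noteq> 0)" for v
  have "\<exists>v. P v"
  proof (cases "dot I e (b i) = 0")
    case True
    then have "P (b i)"
      using Suc.prems M_pos by (auto simp: P_def b_vecs dual intro!: exI[of _ i])
    then show ?thesis by blast
  next
    case False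
    \<comment> \<open>Eliminating \<open>e\<close> between \<open>b i\<close> and
      \<open>b (Suc i)\<close> gives a kernel vector whose coordinate at \<open>Suc i\<close> is
      \<open>- M * dot I e (b i)\<close>, which is nonzero.\<close>
    define v where "v p = dot I e (b (Suc i)) * b i p - dot I e (b i) * b (Suc i) p" for p
    have "dot I a v = dot I e (b (Suc i)) * dot I a (b i) - dot I e (b i) * dot I a (b (Suc i))" for a
      by (simp add: v_def[abs_def] dot_diff dot_scale)
    moreover have "v \<in> vecs I"
      using b_vecs[of i] b_vecs[of "Suc i"] Suc.prems by (auto simp: v_def vecs_def)
    ultimately have "P v"
      using Suc.prems M_pos False by (auto simp: P_def dual intro!: exI[of _ "Suc i"])
    then show ?thesis by blast
  qed
  then obtain v where v: "P v" and least: "\<And>x. P x \<Longrightarrow> supnorm I v \<le> supnorm I x"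
    using ex_has_least_nat[of P _ "supnorm I"] by auto
  from v obtain l where l: "i \<le> l" "l < ?n" "v \<in> vecs I" "dot I (A l) v \<noteq> 0" and ve: "dot I e v = 0"
    by (auto simp: P_def)
  obtain M' b' A' where fr': "frame I ?n M' b' A'" and b': "\<forall>j<i. b' j = b j" "b' i = v"
    and A': "\<And>j x. \<lbrakk>j \<le> i; \<forall>k. j \<le> k \<and> k < ?n \<longrightarrow> dot I (A k) x = 0\<rbrakk>
      \<Longrightarrow> \<forall>k. j \<le> k \<and> k < ?n \<longrightarrow> dot I (A' k) x = 0"
    using frame_extend[OF fr l] by blast
  have "successive I e ?n b' A' (Suc i)"
    unfolding successive_def
  proof (intro allI impI)
    fix j assume "j < Suc i"
    show "dot I e (b' j) = 0 \<and> (\<forall>x\<in>vecs I. dot I e x = 0 \<and> supnorm I x < supnorm I (b' j)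
      \<longrightarrow> (\<forall>l. j \<le> l \<and> l < ?n \<longrightarrow> dot I (A' l) x = 0))"
    proof (cases "j = i")
      case True
      have "\<forall>l. i \<le> l \<and> l < ?n \<longrightarrow> dot I (A l) x = 0"
        if "x \<in> vecs I" "dot I e x = 0" "supnorm I x < supnorm I v" for x
        using least[of x] that by (auto simp: P_def)
      then show ?thesis
        unfolding True using b' ve A'[of i] by simp
    next
      case False
      then have "j < i"
        using \<open>j < Suc i\<close> by simp
      then show ?thesis
        using succ b' A'[of j] by (simp add: successive_def)
    qed
  qed
  with fr' show ?case by blast
qed

section \<open>Comparing class counts with minima and with values of the form\<close>

lemma card_image_le_factor:
  assumes "finite S" "\<And>x y. x \<in> S \<Longrightarrow> y \<in> S \<Longrightarrow> g x = g y \<Longrightarrow> f x = f y"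
  shows "card (f ` S) \<le> card (g ` S)"
proof -
  have "f x = (f \<circ> inv_into S g) (g x)" if "x \<in> S" for x
    using assms(2)[of x "inv_into S g (g x)"] that by (simp add: inv_into_into f_inv_into_f)
  then have "f ` S \<subseteq> (f \<circ> inv_into S g) ` (g ` S)"
    by (auto simp: image_iff)
  then have "card (f ` S) \<le> card ((f \<circ> inv_into S g) ` (g ` S))"
    using assms(1) by (intro card_mono) auto
  also have "\<dots> \<le> card (g ` S)"
    using assms(1) by (intro card_image_le) auto
  finally show ?thesis .
qed

text \<open>The values lie in an integer interval of length
  \<open>(k - 1) * (\<Sum>p\<in>I. \<bar>e p\<bar>)\<close>. Its extra endpoint is absorbed because
  the sum is at least 1.\<close>

lemma card_dot_cube:
  assumes "finite I" "p \<in> I" "e p \<noteq> 0" "k > 0"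
  shows "int (card (dot I e ` cube I k)) \<le> int k * (\<Sum>p\<in>I. \<bar>e p\<bar>)"
proof -
  define lo where "lo = (\<Sum>p\<in>I. min 0 (e p * (int k - 1)))"
  define hi where "hi = (\<Sum>p\<in>I. max 0 (e p * (int k - 1)))"
  have range: "min 0 (e p * (int k - 1)) \<le> e p * x p \<and> e p * x p \<le> max 0 (e p * (int k - 1))"
    if "x \<in> cube I k" "p \<in> I" for x p
  proof -
    have x: "0 \<le> x p" "x p \<le> int k - 1"
      using that by (auto simp: cube_def)
    show ?thesis
    proof (cases "e p \<ge> 0")
      case True
      then show ?thesis
        using x mult_left_mono[OF x(2), of "e p"] by (auto simp: min_def max_def)
    next
      case False
      then have "e p * x p \<le> 0" "e p * (int k - 1) \<le> e p * x p"
        using x mult_left_mono_neg[OF x(2), of "e p"] by (auto simp: mult_nonpos_nonneg)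
      then show ?thesis by simp
    qed
  qed
  have "dot I e ` cube I k \<subseteq> {lo..hi}"
    using range by (auto simp: dot_def lo_def hi_def intro!: sum_mono)
  then have "card (dot I e ` cube I k) \<le> card {lo..hi}"
    by (intro card_mono) auto
  moreover have "hi - lo = (\<Sum>p\<in>I. \<bar>e p\<bar> * (int k - 1))"
    unfolding hi_def lo_def sum_subtractf[symmetric]
    by (rule sum.cong) (use assms(4) in \<open>auto simp: min_def max_def abs_mult abs_if zero_le_mult_iff mult_le_0_iff\<close>)
  moreover have "(\<Sum>p\<in>I. \<bar>e p\<bar>) \<ge> 1"
  proof -
    have "\<bar>e p\<bar> \<le> (\<Sum>p\<in>I. \<bar>e p\<bar>)"
      by (rule member_le_sum) (use assms in auto)
    then show ?thesis
      using assms(3) by linarith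
  qed
  moreover from this have "(\<Sum>p\<in>I. \<bar>e p\<bar>) * (int k - 1) \<ge> 0"
    using assms(4) by simp
  ultimately have "int (card (dot I e ` cube I k)) \<le> (\<Sum>p\<in>I. \<bar>e p\<bar>) * (int k - 1) + 1"
    by (simp add: sum_distrib_right[symmetric])
  also have "\<dots> \<le> (\<Sum>p\<in>I. \<bar>e p\<bar>) * (int k - 1) + (\<Sum>p\<in>I. \<bar>e p\<bar>)"
    using \<open>(\<Sum>p\<in>I. \<bar>e p\<bar>) \<ge> 1\<close> by simp
  also have "\<dots> = int k * (\<Sum>p\<in>I. \<bar>e p\<bar>)"
    by (simp only: right_diff_distrib mult.right_neutral diff_add_cancel mult.commute[of _ "int k"])
  finally show ?thesis .
qed

context frame
begin

lemma classes_0: "classes 0 k = k ^ card I"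
proof -
  have "inj_on (\<lambda>x. tail 0 (coords x)) (cube I k)"
  proof (rule inj_onI)
    fix x y assume x: "x \<in> cube I k" "y \<in> cube I k" and "tail 0 (coords x) = tail 0 (coords y)"
    then have "coords x = coords y"
      by (simp add: tail_def[abs_def])
    then have "M * x p = M * y p" for p
      using comb_coords x by (metis (no_types, lifting) cube_def mem_Collect_eq)
    then show "x = y"
      using M_pos by auto
  qed
  then show ?thesis
    by (simp add: classes_def card_image card_cube finite_I)
qed

lemma supnorm_b_pos:
  assumes "j < n"
  shows "0 < supnorm I (b j)"
proof (rule ccontr)
  assume "\<not> 0 < supnorm I (b j)"
  then have "b j p = 0" for p
    using supnorm_ge[OF finite_I b_vecs[OF assms], of p] by simp
  then have "dot I (A j) (b j) = 0"
    by (simp add: dot_def)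
  then show False
    using dual[OF assms assms] M_pos by simp
qed

text \<open>If \<open>b j'\<close> were shorter than \<open>b j\<close>, minimality of
  \<open>b j\<close> would put it in the span of \<open>b 0, ..., b (j - 1)\<close>, against duality
  with \<open>A j'\<close>.\<close>

lemma supnorm_mono:
  assumes succ: "successive I e n b A i" and "j \<le> j'" "j' < i" "i \<le> n"
  shows "supnorm I (b j) \<le> supnorm I (b j')"
proof (rule ccontr)
  assume less: "\<not> supnorm I (b j) \<le> supnorm I (b j')"
  have "dot I e (b j') = 0" "b j' \<in> vecs I" "j < i" "j' < n"
    using succ assms b_vecs[of j'] by (auto simp: successive_def)
  then have "dot I (A j') (b j') = 0"
    using succ less \<open>j \<le> j'\<close> unfolding successive_def by (metis linorder_not_le)
  then show False
    using dual[of j' j'] M_pos assms by simp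
qed

lemma tail_coords_eqD:
  assumes "tail i (coords x) = tail i (coords y)" "i \<le> l" "l < n"
  shows "dot I (A l) (\<lambda>p. x p - y p) = 0"
  using fun_cong[OF assms(1), of l] assms(2,3) by (simp add: tail_def coords_def dot_diff)

text \<open>Two points equivalent modulo the first \<open>Suc i\<close> vectors differ by a kernel
  vector, since those vectors lie in the kernel. The cube is half-open, so the difference is
  strictly shorter than \<open>b i\<close>, and minimality puts it in the span of the first
  \<open>i\<close> vectors.\<close>

lemma classes_Suc:
  assumes succ: "successive I e n b A (n - 1)" and i: "i < n - 1" and ne: "I \<noteq> {}"
  shows "classes i (supnorm I (b i)) \<le> classes (Suc i) (supnorm I (b i))"
  unfolding classes_def
proof (rule card_image_le_factor)
  fix x y assume x: "x \<in> cube I (supnorm I (b i))" and y: "y \<in> cube I (supnorm I (b i))"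
    and eq: "tail (Suc i) (coords x) = tail (Suc i) (coords y)"
  define w where "w = (\<lambda>p. x p - y p)"
  have w: "w \<in> vecs I"
    using x y by (auto simp: w_def cube_def vecs_def)
  have "dot I (A l) w * dot I e (b l) = 0" if "l < n" for l
  proof (cases "Suc i \<le> l")
    case True
    then show ?thesis
      using tail_coords_eqD[OF eq True that] by (simp add: w_def)
  next
    case False
    then show ?thesis
      using succ i by (simp add: successive_def)
  qed
  then have "M * dot I e w = 0"
    unfolding dot_expand[OF w] by (intro sum.neutral) simp
  then have "dot I e w = 0"
    using M_pos by simp
  moreover have "supnorm I w < supnorm I (b i)"
  proof (intro supnorm_less finite_I ne)
    fix p assume "p \<in> I"
    then have "0 \<le> x p" "x p < int (supnorm I (b i))" "0 \<le> y p" "y p < int (supnorm I (b i))"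
      using x y by (auto simp: cube_def)
    then show "\<bar>w p\<bar> < int (supnorm I (b i))"
      unfolding w_def by linarith
  qed
  ultimately have z: "dot I (A l) w = 0" if "i \<le> l" "l < n" for l
    using succ i w that by (auto simp: successive_def)
  show "tail i (coords x) = tail i (coords y)"
  proof
    fix l show "tail i (coords x) l = tail i (coords y) l"
      using z[of l] by (auto simp: tail_def coords_def w_def dot_diff)
  qed
qed (simp add: finite_cube finite_I)

text \<open>The form kills all frame vectors except the last, so its value determines the last
  coordinate, the only one that \<open>tail (n - 1)\<close> retains.\<close>

lemma classes_last:
  assumes succ: "successive I e n b A (n - 1)" and "p \<in> I" "e p \<noteq> 0"
  shows "classes (n - 1) k \<le> card (dot I e ` cube I k)"
  unfolding classes_def
proof (rule card_image_le_factor)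
  fix x y assume x: "x \<in> cube I k" "y \<in> cube I k" and eq: "dot I e x = dot I e y"
  define w where "w = (\<lambda>p. x p - y p)"
  have w: "w \<in> vecs I"
    using x by (auto simp: w_def cube_def vecs_def)
  obtain j where j: "j < n" "dot I e (b j) \<noteq> 0"
    using kernel_proper[of p e] assms(2,3) by blast
  then have jn: "j = n - 1"
    using succ unfolding successive_def by (cases "j < n - 1") auto
  have "0 = M * dot I e w"
    using eq by (simp add: w_def dot_diff)
  also have "\<dots> = (\<Sum>l<n. if l = n - 1 then dot I (A (n - 1)) w * dot I e (b (n - 1)) else 0)"
    unfolding dot_expand[OF w, of e] using succ
    by (intro sum.cong) (auto simp: successive_def)
  finally have "dot I (A (n - 1)) w = 0"
    using j jn by simp
  then have "dot I (A l) x = dot I (A l) y" if "n - 1 \<le> l" "l < n" for l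
  proof -
    have "l = n - 1"
      using that by simp
    then show ?thesis
      using \<open>dot I (A (n - 1)) w = 0\<close> by (simp add: w_def dot_diff)
  qed
  then show "tail (n - 1) (coords x) = tail (n - 1) (coords y)"
    by (auto simp: tail_def coords_def fun_eq_iff)
qed (simp add: finite_cube finite_I)

text \<open>Induction along the minima: \<open>classes_growth\<close> enlarges the cube to the next
  minimum, and \<open>classes_Suc\<close> then divides out one more vector at no loss.\<close>

lemma prod_supnorm_le_classes:
  assumes succ: "successive I e n b A (n - 1)" and n: "n = card I"
  shows "i < n - 1 \<Longrightarrow> (\<Prod>j\<le>i. supnorm I (b j)) * supnorm I (b i) ^ (n - Suc i)
    \<le> classes (Suc i) (supnorm I (b i))"
proof (induction i)
  case 0
  then have "classes 0 (supnorm I (b 0)) \<le> classes (Suc 0) (supnorm I (b 0))"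
    using n by (intro classes_Suc[OF succ]) auto
  moreover have "supnorm I (b 0) ^ n = supnorm I (b 0) * supnorm I (b 0) ^ (n - Suc 0)"
    using 0 by (metis Suc_pred' bot_nat_0.not_eq_extremum diff_0_eq_0 not_less_zero power_Suc One_nat_def)
  ultimately show ?case
    using classes_0[of "supnorm I (b 0)"] by (simp add: n[symmetric])
next
  case (Suc i)
  let ?l = "supnorm I (b i)" and ?l' = "supnorm I (b (Suc i))"
  have l: "0 < ?l" "?l \<le> ?l'"
    using Suc.prems supnorm_b_pos[of i] supnorm_mono[OF succ, of i "Suc i"] by auto
  have "?l' ^ (n - Suc i) * ((\<Prod>j\<le>i. supnorm I (b j)) * ?l ^ (n - Suc i))
      \<le> ?l' ^ (n - Suc i) * classes (Suc i) ?l"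
    using Suc by (intro mult_left_mono) auto
  also have "\<dots> \<le> ?l ^ (n - Suc i) * classes (Suc i) ?l'"
    using l by (rule classes_growth)
  finally have "?l ^ (n - Suc i) * ((\<Prod>j\<le>i. supnorm I (b j)) * ?l' ^ (n - Suc i))
      \<le> ?l ^ (n - Suc i) * classes (Suc i) ?l'"
    by (simp add: mult_ac)
  then have "(\<Prod>j\<le>i. supnorm I (b j)) * ?l' ^ (n - Suc i) \<le> classes (Suc i) ?l'"
    using l by simp
  also have "\<dots> \<le> classes (Suc (Suc i)) ?l'"
    using Suc.prems n by (intro classes_Suc[OF succ]) auto
  finally have "(\<Prod>j\<le>i. supnorm I (b j)) * ?l' ^ (n - Suc i) \<le> classes (Suc (Suc i)) ?l'" .
  \<comment> \<open>One factor \<open>?l'\<close> moves from the power into the product.\<close>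
  moreover have "n - Suc i = Suc (n - Suc (Suc i))"
    using Suc.prems by simp
  ultimately show ?case
    by (simp add: mult.assoc)
qed

text \<open>The exponent in \<open>prod_supnorm_le_classes\<close> ends at 1; this extra copy of the
  last minimum cancels the side length in \<open>card_dot_cube\<close>.\<close>

lemma prod_supnorm_le:
  assumes succ: "successive I e n b A (n - 1)" and n: "n = card I" and p: "p \<in> I" "e p \<noteq> 0"
  shows "int (\<Prod>j<n - 1. supnorm I (b j)) \<le> (\<Sum>p\<in>I. \<bar>e p\<bar>)"
proof (cases "n - 1")
  case 0
  have "\<bar>e p\<bar> \<le> (\<Sum>p\<in>I. \<bar>e p\<bar>)"
    by (rule member_le_sum) (use p finite_I in auto)
  then show ?thesis
    using 0 p by simp
next
  case (Suc i)
  let ?l = "supnorm I (b i)"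
  have l: "?l > 0"
    using Suc by (intro supnorm_b_pos) auto
  have "n - Suc i = 1"
    using Suc by simp
  then have "(\<Prod>j<n - 1. supnorm I (b j)) * ?l \<le> classes (n - 1) ?l"
    using prod_supnorm_le_classes[OF succ n, of i] Suc by (simp add: lessThan_Suc_atMost)
  also have "\<dots> \<le> card (dot I e ` cube I ?l)"
    by (rule classes_last[where p = p]) (use succ p in auto)
  finally have "int (\<Prod>j<n - 1. supnorm I (b j)) * int ?l \<le> int (card (dot I e ` cube I ?l))"
    by (simp only: of_nat_mult[symmetric] of_nat_le_iff)
  also have "\<dots> \<le> int ?l * (\<Sum>p\<in>I. \<bar>e p\<bar>)"
    by (rule card_dot_cube[where p = p]) (use finite_I p l in auto)
  finally show ?thesis
    using l by (simp add: mult.commute)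
qed

end

subsection \<open>Dimension of the solution lattice\<close>

text \<open>Steinitz exchange, one vector at a time; a missing pivot would give a linear relation
  among the \<open>x j\<close>.\<close>

lemma exists_frame_extending:
  assumes "finite I" "i \<le> card I" and x: "\<And>j. j < card I \<Longrightarrow> x j \<in> vecs I"
    and ind: "\<And>u j. \<lbrakk>\<And>p. p \<in> I \<Longrightarrow> (\<Sum>j<card I. u j * x j p) = 0; j < card I\<rbrakk> \<Longrightarrow> u j = (0::int)"
  shows "\<exists>M b A. frame I (card I) M b A \<and> (\<forall>j<i. b j = x j)"
  using assms(2)
proof (induction i)
  case 0
  then show ?case
    using frame_unit[OF assms(1)] by auto
next
  case (Suc i)
  let ?n = "card I"
  from Suc obtain M b A where fr: "frame I ?n M b A" and b: "\<forall>j<i. b j = x j"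
    by auto
  interpret frame I ?n M b A by fact
  have "\<exists>l\<ge>i. l < ?n \<and> dot I (A l) (x i) \<noteq> 0"
  proof (rule ccontr)
    assume "\<not> (\<exists>l\<ge>i. l < ?n \<and> dot I (A l) (x i) \<noteq> 0)"
    then have z: "dot I (A l) (x i) = 0" if "i \<le> l" "l < ?n" for l
      using that by auto
    \<comment> \<open>With its later coordinates zero, the expansion of \<open>M * x i\<close>
      involves only \<open>x 0, ..., x (i - 1)\<close>; \<open>u\<close> records this
      relation.\<close>
    define u where "u j = (if j < i then dot I (A j) (x i) else if j = i then - M else 0)" for j
    have "(\<Sum>j<?n. u j * x j p) = 0" if p: "p \<in> I" for p
    proof -
      have "(\<Sum>j<?n. u j * x j p)
          = (\<Sum>j<?n. dot I (A j) (x i) * b j p + (if j = i then - M * x i p else 0))"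
        using b z by (intro sum.cong) (auto simp: u_def)
      also have "\<dots> = 0"
        using expand[OF x p, of i] Suc.prems by (simp add: sum.distrib)
      finally show ?thesis .
    qed
    then have "u i = 0"
      by (rule ind[where u = u]) (use Suc.prems in simp_all)
    then show False
      using M_pos by (simp add: u_def)
  qed
  then obtain l where l: "i \<le> l" "l < ?n" "dot I (A l) (x i) \<noteq> 0"
    by blast
  obtain M' b' A' where "frame I ?n M' b' A'" "\<forall>j<i. b' j = b j" "b' i = x i"
    using frame_extend[OF fr l(1,2) x l(3)] l by auto
  with b show ?case
    by (auto simp: less_Suc_eq)
qed

text \<open>Otherwise the \<open>x j\<close> would form a frame inside the kernel of
  \<open>e\<close>, against \<open>kernel_proper\<close>.\<close>

lemma hyperplane_dependent:
  assumes "finite I" "p \<in> I" "e p \<noteq> 0"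
    and x: "\<And>j. j < card I \<Longrightarrow> x j \<in> vecs I \<and> dot I e (x j) = 0"
  shows "\<exists>u :: nat \<Rightarrow> int. (\<forall>p\<in>I. (\<Sum>j<card I. u j * x j p) = 0) \<and> (\<exists>j<card I. u j \<noteq> 0)"
proof (rule ccontr)
  assume *: "\<not> ?thesis"
  have ind: "u j = 0" if "\<And>p. p \<in> I \<Longrightarrow> (\<Sum>j<card I. u j * x j p) = 0" "j < card I"
    for u :: "nat \<Rightarrow> int" and j
    using * that by blast
  obtain M b A where fr: "frame I (card I) M b A" and b: "\<forall>j<card I. b j = x j"
    using exists_frame_extending[OF assms(1) le_refl, of x] x ind by blast
  interpret frame I "card I" M b A by fact
  show False
    using kernel_proper[of p e] assms(2,3) x b by auto
qed

subsection \<open>The linear form defining \<open>\<T>(a, b)\<close>\<close>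

lemma inj_int_of_prime: "inj int_of_prime"
  by (auto simp: inj_def int_of_prime_def nat_of_prime_inject)

lemma finite_supp:
  assumes "N \<noteq> 0"
  shows "finite (supp N)"
proof (rule inj_on_finite)
  show "inj_on int_of_prime (supp N)"
    using inj_int_of_prime by (rule inj_on_subset) simp
  show "int_of_prime ` supp N \<subseteq> {..\<bar>N\<bar>} \<inter> {0..}"
    using assms dvd_imp_le_int[of N] by (force simp: supp_def int_of_prime_def)
  have "{..\<bar>N\<bar>} \<inter> {0..} = {0..\<bar>N\<bar>}" by auto
  then show "finite ({..\<bar>N\<bar>} \<inter> {0..})" by simp
qed

lemma exists_int_of_prime_dvd:
  assumes "N > 1"
  obtains p where "int_of_prime p dvd N"
proof -
  have "nat N \<noteq> 1"
    using assms by simp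
  then obtain q :: nat where q: "prime q" "q dvd nat N"
    using prime_factor_nat by blast
  then have "nat_of_prime (prime_of_nat q) = q"
    by (simp add: prime_of_nat_inverse)
  then have "int_of_prime (prime_of_nat q) dvd N"
    using q assms int_dvd_int_iff[of q "nat N"] by (simp add: int_of_prime_def)
  then show thesis by (rule that)
qed

lemma two_le_int_of_prime: "2 \<le> int_of_prime p"
  using prime_int_of_prime by (rule prime_ge_2_int)

text \<open>One prime comes from whichever of \<open>a\<close>, \<open>b\<close> exceeds 1, another
  from \<open>a + b\<close>; coprimality separates them.\<close>

lemma omega_ge_2:
  assumes "a > 0" "b > 0" "coprime a b" "a + b > 2"
  shows "2 \<le> omega (a * b * (a + b))"
proof -
  have "\<exists>N. N > 1 \<and> N dvd a * b \<and> coprime N (a + b)"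
  proof (cases "a > 1")
    case True
    have "coprime a (a + b)"
      using assms(3) gcd_add2[of a b] by (simp only: coprime_iff_gcd_eq_1)
    with True show ?thesis by (intro exI[of _ a]) auto
  next
    case False
    have "coprime b (a + b)"
      using assms(3) gcd_add2[of b a] by (simp only: coprime_iff_gcd_eq_1 add.commute gcd.commute)
    with False show ?thesis using assms by (intro exI[of _ b]) auto
  qed
  then obtain N where N: "N > 1" "N dvd a * b" "coprime N (a + b)" by blast
  obtain p where p: "int_of_prime p dvd N"
    using exists_int_of_prime_dvd[OF N(1)] .
  obtain q where q: "int_of_prime q dvd a + b"
    using exists_int_of_prime_dvd[of "a + b"] assms by auto
  have "p \<noteq> q"
  proof
    assume "p = q"
    then have "is_unit (int_of_prime p)"
      using N(3) p q by (meson coprime_common_divisor)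
    then show False
      using two_le_int_of_prime[of p] by simp
  qed
  moreover have "{p, q} \<subseteq> supp (a * b * (a + b))"
    using p q N(2) by (auto simp: supp_def intro: dvd_mult2 dvd_mult dvd_trans)
  then have "card {p, q} \<le> omega (a * b * (a + b))"
    unfolding omega_def using assms by (intro card_mono finite_supp) auto
  ultimately show ?thesis by simp
qed

text \<open>The coefficient of \<open>xi p\<close> in \<open>d N\<close> for nonzero
  \<open>N\<close>; off the support the same formula gives 0.\<close>

definition coef :: "int \<Rightarrow> prime_number \<Rightarrow> int"
  where "coef N p = (N * int (multiplicity (int_of_prime p) N)) div int_of_prime p"

lemma coef_eq_0: "p \<notin> supp N \<Longrightarrow> coef N p = 0"
  by (simp add: coef_def supp_def not_dvd_imp_multiplicity_0)

lemma coef_pos: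
  assumes "N > 0" "p \<in> supp N"
  shows "coef N p > 0"
proof -
  have dvd: "int_of_prime p dvd N"
    using assms by (simp add: supp_def)
  have "multiplicity (int_of_prime p) N > 0"
    using dvd assms two_le_int_of_prime[of p] by (subst multiplicity_gt_zero_iff) auto
  then have "N * 1 \<le> N * int (multiplicity (int_of_prime p) N)"
    using assms by (intro mult_left_mono) auto
  moreover have "int_of_prime p \<le> N"
    using dvd assms by (simp add: zdvd_imp_le)
  ultimately have "int_of_prime p \<le> N * int (multiplicity (int_of_prime p) N)"
    by linarith
  then show ?thesis
    using two_le_int_of_prime[of p] by (simp add: coef_def pos_imp_zdiv_pos_iff)
qed

text \<open>With \<open>q\<close> the prime and \<open>v\<close> its multiplicity,
  \<open>q ^ v \<le> N\<close> bounds \<open>v\<close> by \<open>ln N / ln q\<close>. The remaining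
  denominator \<open>q * ln q\<close> is smallest at \<open>q = 2\<close>, whence
  \<open>2 * ln 2\<close>.\<close>

lemma coef_le:
  assumes N: "0 < N" "N \<le> c"
  shows "real_of_int (coef N p) \<le> c * ln c / (2 * ln 2)"
proof -
  define q where "q = real_of_int (int_of_prime p)"
  define v where "v = multiplicity (int_of_prime p) N"
  have q: "2 \<le> q"
    unfolding q_def using two_le_int_of_prime[of p] by linarith
  have "int_of_prime p ^ v \<le> N"
    unfolding v_def using N by (intro zdvd_imp_le multiplicity_dvd)
  then have "q ^ v \<le> N"
    unfolding q_def by (metis of_int_le_iff of_int_power)
  then have "ln (q ^ v) \<le> ln N"
    using q N by (intro ln_le_cancel_iff[THEN iffD2]) auto
  then have v: "real v * ln q \<le> ln N"
    using q by (simp add: ln_realpow)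
  have "2 * ln 2 \<le> q * ln q"
    using q by (intro mult_mono ln_mono) auto
  have "real_of_int (coef N p) \<le> N * real v / q"
    unfolding coef_def q_def v_def using real_of_int_div4[of "N * int (multiplicity (int_of_prime p) N)"] by simp
  also have "\<dots> = N * (real v * ln q) / (q * ln q)"
    using q by simp
  also have "\<dots> \<le> N * ln N / (q * ln q)"
    using v q N by (intro divide_right_mono mult_left_mono) auto
  also have "\<dots> \<le> c * ln c / (q * ln q)"
    using q N by (intro divide_right_mono mult_mono ln_mono) auto
  also have "\<dots> \<le> c * ln c / (2 * ln 2)"
    using \<open>2 * ln 2 \<le> q * ln q\<close> N q by (intro divide_left_mono) auto
  finally show ?thesis .
qed

text \<open>The coefficient vector of the linear equation expressing additivity of
  \<open>d_along \<psi>\<close> at \<open>a\<close>, \<open>b\<close>.\<close>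

definition leibniz_form :: "int \<Rightarrow> int \<Rightarrow> prime_number \<Rightarrow> int"
  where "leibniz_form a b p = coef (a + b) p - coef a p - coef b p"

lemma supp_mult: "supp (x * y) = supp x \<union> supp y"
  by (auto simp: supp_def prime_dvd_mult_iff prime_int_of_prime)

text \<open>Since \<open>a\<close>, \<open>b\<close>, \<open>a + b\<close> are pairwise coprime,
  exactly one of the three terms of the form survives at \<open>p\<close>.\<close>

lemma leibniz_form_supp:
  assumes ab: "a > 0" "b > 0" "coprime a b" and p: "p \<in> supp (a * b * (a + b))"
  shows "leibniz_form a b p \<noteq> 0"
    and "\<bar>real_of_int (leibniz_form a b p)\<bar> \<le> real_of_int (a + b) * ln (real_of_int (a + b)) / (2 * ln 2)"
proof -
  have two: "False" if "int_of_prime p dvd a" "int_of_prime p dvd b"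
    using coprime_common_divisor[OF ab(3) that] two_le_int_of_prime[of p] by simp
  have cases: "p \<in> supp a \<and> p \<notin> supp b \<and> p \<notin> supp (a + b)
      \<or> p \<notin> supp a \<and> p \<in> supp b \<and> p \<notin> supp (a + b)
      \<or> p \<notin> supp a \<and> p \<notin> supp b \<and> p \<in> supp (a + b)"
    using p two dvd_add_right_iff[of "int_of_prime p" a b] dvd_add_left_iff[of "int_of_prime p" b a]
    unfolding supp_mult by (auto simp: supp_def)
  then have "\<exists>N\<in>{a, b, a + b}. p \<in> supp N \<and> \<bar>leibniz_form a b p\<bar> = coef N p"
    using coef_pos[of a p] coef_pos[of b p] coef_pos[of "a + b" p] ab
    by (elim disjE) (simp_all add: leibniz_form_def coef_eq_0)
  then obtain N where "N \<in> {a, b, a + b}" "p \<in> supp N" "\<bar>leibniz_form a b p\<bar> = coef N p"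
    by blast
  moreover from this have "coef N p > 0" "real_of_int (coef N p) \<le> real_of_int (a + b) * ln (real_of_int (a + b)) / (2 * ln 2)"
    using ab by (auto intro!: coef_pos coef_le)
  ultimately show "leibniz_form a b p \<noteq> 0"
    and "\<bar>real_of_int (leibniz_form a b p)\<bar> \<le> real_of_int (a + b) * ln (real_of_int (a + b)) / (2 * ln 2)"
    by auto
qed

lemma d_along_eq:
  assumes "Z_linear \<psi>" "N \<noteq> 0" "supp N \<subseteq> I" "finite I"
  shows "d_along \<psi> N = dot I (coef N) (\<lambda>p. \<psi> (xi p))"
proof -
  have add: "\<psi> (x + y) = \<psi> x + \<psi> y" and scale: "\<psi> (frag_cmul k x) = k * \<psi> x" for x y k
    using assms(1) by (auto simp: Z_linear_iff)
  have "\<psi> 0 = 0"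
    using add[of 0 0] by simp
  then have sum: "\<psi> (sum f S) = (\<Sum>p\<in>S. \<psi> (f p))" for f and S :: "prime_number set"
    by (induction S rule: infinite_finite_induct) (simp_all add: add)
  have "d_along \<psi> N = (\<Sum>p\<in>supp N. coef N p * \<psi> (xi p))"
    using assms(2) by (simp add: d_along_def d_def sum scale coef_def)
  also have "\<dots> = dot I (coef N) (\<lambda>p. \<psi> (xi p))"
    unfolding dot_def using assms by (intro sum.mono_neutral_left) (auto simp: coef_eq_0)
  finally show ?thesis .
qed

lemma derivations_ab_iff:
  assumes "a > 0" "b > 0"
  defines "I \<equiv> supp (a * b * (a + b))"
  shows "\<psi> \<in> derivations_ab a b \<longleftrightarrow> \<psi> \<in> derivations \<and> (\<lambda>p. \<psi> (xi p)) \<in> vecs I \<and>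
    dot I (leibniz_form a b) (\<lambda>p. \<psi> (xi p)) = 0"
proof (cases "\<psi> \<in> derivations")
  case True
  have fin: "finite I"
    unfolding I_def using assms(1,2) by (intro finite_supp) auto
  have "d_along \<psi> N = dot I (coef N) (\<lambda>p. \<psi> (xi p))" if "N \<in> {a, b, a + b}" for N
  proof (rule d_along_eq)
    show "Z_linear \<psi>"
      using True by (simp add: derivations_def)
    show "N \<noteq> 0" "supp N \<subseteq> I"
      using that assms(1,2) unfolding I_def supp_mult by auto
  qed (rule fin)
  moreover have "dot I (leibniz_form a b) x
      = dot I (coef (a + b)) x - dot I (coef a) x - dot I (coef b) x" for x
    by (simp add: dot_def leibniz_form_def[abs_def] left_diff_distrib sum_subtractf)
  ultimately show ?thesis
    using True by (auto simp: derivations_ab_def supp_deriv_def vecs_def I_def)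
qed (simp add: derivations_ab_def)

subsection \<open>Derivations as integer vectors\<close>

text \<open>The linear extension of \<open>x\<close> from the basis; summing over \<open>I\<close>
  suffices for \<open>x\<close> in \<open>vecs I\<close>.\<close>

definition linear_of :: "prime_number set \<Rightarrow> (prime_number \<Rightarrow> int) \<Rightarrow> Omega \<Rightarrow> int"
  where "linear_of I x \<omega> = dot I x (poly_mapping.lookup \<omega>)"

lemma linear_of_xi:
  assumes "finite I" "x \<in> vecs I"
  shows "linear_of I x (xi p) = x p"
proof -
  have "linear_of I x (xi p) = (\<Sum>q\<in>I. if p = q then x q else 0)"
    unfolding linear_of_def dot_def by (intro sum.cong) auto
  also have "\<dots> = x p"
    using assms by (simp add: vecs_def)
  finally show ?thesis .
qed

lemma linear_of_derivation:
  assumes "finite I" "x \<in> vecs I"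
  shows "linear_of I x \<in> derivations"
proof (rule derivationsI)
  show "linear_of I x (v + w) = linear_of I x v + linear_of I x w" for v w
    by (simp add: linear_of_def dot_def lookup_add distrib_left sum.distrib)
  show "linear_of I x (frag_cmul k v) = k * linear_of I x v" for k v
    by (simp add: linear_of_def dot_def sum_distrib_left mult.left_commute)
  show "\<bar>linear_of I x (xi p)\<bar> \<le> int (supnorm I x)" for p
    using supnorm_ge[OF assms] by (simp add: linear_of_xi[OF assms])
qed

lemma deriv_norm_linear_of:
  assumes "finite I" "I \<noteq> {}" "x \<in> vecs I"
  shows "deriv_norm (linear_of I x) = ereal (real (supnorm I x))"
proof (rule antisym)
  show "deriv_norm (linear_of I x) \<le> ereal (real (supnorm I x))"
    unfolding deriv_norm_def
  proof (rule SUP_least)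
    fix p
    have "real_of_int \<bar>x p\<bar> \<le> real_of_int (int (supnorm I x))"
      unfolding of_int_le_iff by (rule supnorm_ge[OF assms(1,3)])
    then show "ereal (real_of_int \<bar>linear_of I x (xi p)\<bar>) \<le> ereal (real (supnorm I x))"
      by (simp add: linear_of_xi[OF assms(1,3)])
  qed
  have "supnorm I x \<in> (\<lambda>p. nat \<bar>x p\<bar>) ` I"
    unfolding supnorm_def using assms by (intro Max_in) auto
  then obtain p where "supnorm I x = nat \<bar>x p\<bar>" by blast
  then have "ereal (real (supnorm I x)) = ereal (real_of_int \<bar>linear_of I x (xi p)\<bar>)"
    by (simp add: linear_of_xi[OF assms(1,3)])
  also have "\<dots> \<le> deriv_norm (linear_of I x)"
    unfolding deriv_norm_def by (rule SUP_upper) simp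
  finally show "ereal (real (supnorm I x)) \<le> deriv_norm (linear_of I x)" .
qed

lemma sum_scale_map_apply: "(\<Sum>v\<in>t. scale_map (u v) v) \<omega> = (\<Sum>v\<in>t. u v * v \<omega>)"
  by (induction t rule: infinite_finite_induct) (simp_all add: scale_map_def)

lemma derivation_eq_0:
  assumes "\<phi> \<in> derivations" "\<And>p. \<phi> (xi p) = 0"
  shows "\<phi> = 0"
proof
  fix \<omega>
  obtain C where add: "\<And>x y. \<phi> (x + y) = \<phi> x + \<phi> y" and "\<And>k x. \<phi> (frag_cmul k x) = k * \<phi> x"
      "\<And>p. \<bar>\<phi> (xi p)\<bar> \<le> C"
    using derivationsE[OF assms(1)] by blast
  have "\<phi> (x - y) = \<phi> x - \<phi> y" for x y
    using add[of "x - y" y] by simp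
  moreover have "\<phi> 0 = 0"
    using add[of 0 0] by simp
  ultimately have "\<phi> \<omega> = 0"
    by (induction \<omega> rule: frag_induction[OF subset_UNIV]) (simp_all add: assms(2))
  then show "\<phi> \<omega> = 0 \<omega>" by simp
qed

text \<open>The value vectors of \<open>card I\<close> members of \<open>B\<close> lie in one
  hyperplane, so \<open>hyperplane_dependent\<close> relates them. A relation between values on the
  basis is one between the maps.\<close>

lemma independent_derivations_ab:
  assumes ab: "a > 0" "b > 0" "coprime a b" "a + b > 2"
    and B: "B \<subseteq> derivations_ab a b" "map_module.independent B"
  shows "finite B \<and> card B \<le> omega (a * b * (a + b)) - 1"
proof (rule ccontr)
  define I where "I = supp (a * b * (a + b))"
  have I: "finite I" "2 \<le> card I"
    using ab omega_ge_2[OF ab] by (auto simp: I_def omega_def finite_supp)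
  obtain p where p: "p \<in> I"
    using I by (metis card.empty equals0I not_numeral_le_zero)
  assume "\<not> (finite B \<and> card B \<le> omega (a * b * (a + b)) - 1)"
  then have "infinite B \<or> card I \<le> card B"
    by (auto simp: I_def omega_def)
  then have "\<exists>T\<subseteq>B. finite T \<and> card T = card I"
  proof
    assume "infinite B"
    then show ?thesis
      using infinite_arbitrarily_large[of B "card I"] by blast
  next
    assume "card I \<le> card B"
    then show ?thesis
      by (rule obtain_subset_with_card_n) blast
  qed
  then obtain T where T: "T \<subseteq> B" "finite T" "card T = card I"
    by blast
  obtain h where h: "bij_betw h {..<card I} T"
    using ex_bij_betw_nat_finite[OF T(2)] T(3) by (auto simp: atLeast0LessThan)
  then have hT: "h j \<in> T" if "j < card I" for j
    using that by (auto simp: bij_betw_def)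
  then have h_ab: "h j \<in> derivations_ab a b" if "j < card I" for j
    using that T(1) B(1) by blast
  have "\<exists>u :: nat \<Rightarrow> int. (\<forall>p\<in>I. (\<Sum>j<card I. u j * h j (xi p)) = 0) \<and> (\<exists>j<card I. u j \<noteq> 0)"
    using I(1) p leibniz_form_supp(1)[OF ab(1-3)] h_ab derivations_ab_iff[OF ab(1,2)]
    by (intro hyperplane_dependent[of I p "leibniz_form a b" "\<lambda>j p. h j (xi p)"]) (auto simp: I_def)
  then obtain u :: "nat \<Rightarrow> int" and j
    where u: "\<And>p. p \<in> I \<Longrightarrow> (\<Sum>j<card I. u j * h j (xi p)) = 0" and j: "j < card I" "u j \<noteq> 0"
    by blast
  \<comment> \<open>Transports the coefficients \<open>u\<close> from indices to the maps
    themselves.\<close>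
  define g where "g = inv_into {..<card I} h"
  have g: "g (h j) = j" if "j < card I" for j
    using h that unfolding g_def bij_betw_def by (intro inv_into_f_f) auto
  define \<phi> where "\<phi> = (\<Sum>v\<in>T. scale_map (u (g v)) v)"
  have "\<phi> \<in> derivations"
    unfolding \<phi>_def using T(1) B(1)
    by (intro map_module.subspace_sum subspace_derivations map_module.subspace_scale)
      (auto simp: derivations_ab_def)
  moreover have "\<phi> (xi p) = 0" for p
  proof -
    have "\<phi> (xi p) = (\<Sum>v\<in>T. u (g v) * v (xi p))"
      by (simp add: \<phi>_def sum_scale_map_apply)
    also have "\<dots> = (\<Sum>j<card I. u (g (h j)) * h j (xi p))"
      using h by (rule sum.reindex_bij_betw[symmetric])
    also have "\<dots> = (\<Sum>j<card I. u j * h j (xi p))"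
      using g by simp
    also have "\<dots> = 0"
    proof (cases "p \<in> I")
      case False
      then have "h j (xi p) = 0" if "j < card I" for j
        using h_ab[OF that] derivations_ab_iff[OF ab(1,2), of "h j"] by (auto simp: I_def vecs_def)
      then show ?thesis by simp
    qed (rule u)
    finally show ?thesis .
  qed
  ultimately have "\<phi> = 0"
    by (rule derivation_eq_0)
  then have "u (g (h j)) = 0"
    using map_module.independentD[OF B(2) T(2,1), of "\<lambda>v. u (g v)" "h j"] hT j by (simp add: \<phi>_def)
  then show False
    using g j by simp
qed

text \<open>Pairing a relation with the dual row \<open>A l\<close> isolates the coefficient of
  \<open>b l\<close>, multiplied by \<open>M > 0\<close>.\<close>

lemma independent_linear_of:
  assumes "frame I n M b A" "J \<subseteq> {..<n}"
  shows "inj_on (\<lambda>j. linear_of I (b j)) J" "map_module.independent ((\<lambda>j. linear_of I (b j)) ` J)"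
proof -
  interpret frame I n M b A by fact
  have xi: "linear_of I (b j) (xi p) = b j p" if "j \<in> J" for j p
    using that assms(2) by (intro linear_of_xi finite_I b_vecs) auto
  have val: "dot I (A l) (\<lambda>p. linear_of I (b j) (xi p)) = (if l = j then M else 0)"
    if "j \<in> J" "l \<in> J" for j l
  proof -
    have "l < n" "j < n"
      using that assms(2) by auto
    then show ?thesis
      by (simp add: xi[OF that(1)] dual)
  qed
  show inj: "inj_on (\<lambda>j. linear_of I (b j)) J"
  proof (rule inj_onI)
    fix j l assume "j \<in> J" "l \<in> J" "linear_of I (b j) = linear_of I (b l)"
    then show "j = l"
      using val[of j j] val[of l j] M_pos by (auto split: if_splits)
  qed
  show "map_module.independent ((\<lambda>j. linear_of I (b j)) ` J)"
    unfolding map_module.independent_explicit_module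
  proof (intro allI impI)
    fix t u v assume t: "finite t" "t \<subseteq> (\<lambda>j. linear_of I (b j)) ` J"
      and zero: "(\<Sum>v\<in>t. scale_map (u v) v) = 0" and v: "v \<in> t"
    obtain l where l: "l \<in> J" "v = linear_of I (b l)"
      using t v by auto
    have "(\<Sum>v\<in>t. u v * v (xi p)) = 0" for p
      using sum_scale_map_apply[of u t "xi p"] zero by simp
    then have "0 = dot I (A l) (\<lambda>p. \<Sum>v\<in>t. u v * v (xi p))"
      by (simp add: dot_def)
    also have "\<dots> = (\<Sum>w\<in>t. u w * dot I (A l) (\<lambda>p. w (xi p)))"
      by (rule dot_sum)
    also have "\<dots> = (\<Sum>w\<in>t. if w = v then u v * M else 0)"
    proof (rule sum.cong[OF refl])
      fix w assume "w \<in> t"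
      then obtain j where j: "j \<in> J" "w = linear_of I (b j)"
        using t by auto
      then have "w = v \<longleftrightarrow> l = j"
        using l inj by (auto dest: inj_onD)
      then show "u w * dot I (A l) (\<lambda>p. w (xi p)) = (if w = v then u v * M else 0)"
        using val[OF j(1) l(1)] j by auto
    qed
    also have "\<dots> = u v * M"
      using t v by simp
    finally show "u v = 0"
      using M_pos by simp
  qed
qed

section \<open>The rank of \<open>derivations_ab a b\<close> and the product of the norms\<close>

theorem theorem2p6:
  fixes a b c :: int and r :: nat
  assumes "a > 0" and "b > 0" and "coprime a b"
    and "c = a + b" and "c > 2"
    and "r = omega (a * b * c) - 1"
  shows "r \<ge> 1 \<and> has_rank (derivations_ab a b) r \<and>
    (\<exists>\<psi> :: nat \<Rightarrow> Omega \<Rightarrow> int.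
      (\<forall>i\<in>{1..r}. \<psi> i \<in> derivations_ab a b) \<and>
      inj_on \<psi> {1..r} \<and> map_module.independent (\<psi> ` {1..r}) \<and>
      (\<Prod>i=1..r. deriv_norm (\<psi> i))
        \<le> ereal (real (omega (a * b * c)) / (2 * ln 2) * (real_of_int c * ln (real_of_int c))))"
proof -
  define I where "I = supp (a * b * c)"
  define n where "n = card I"
  define e where "e = leibniz_form a b"
  have n2: "2 \<le> n"
    using omega_ge_2 assms by (simp add: n_def I_def omega_def)
  have fin: "finite I"
    using assms by (simp add: I_def finite_supp)
  have ne: "I \<noteq> {}"
    using n2 by (auto simp: n_def)
  have r: "r = n - 1"
    using assms by (simp add: n_def I_def omega_def)
  obtain p where p: "p \<in> I"
    using ne by blast
  have e: "e p \<noteq> 0" "\<bar>real_of_int (e p)\<bar> \<le> c * ln c / (2 * ln 2)" if "p \<in> I" for p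
    using leibniz_form_supp[OF assms(1-3), of p] that assms by (simp_all add: e_def I_def)
  obtain M v A where "frame I n M v A" and succ: "successive I e n v A (n - 1)"
    using exists_successive[OF fin, of "n - 1" e] n2 by (auto simp: n_def)
  interpret frame I n M v A by fact
  define w where "w j = linear_of I (v j)" for j
  have mem: "w j \<in> derivations_ab a b" if "j < n - 1" for j
    using that succ b_vecs[of j] fin assms(1,2,4) unfolding derivations_ab_iff[OF assms(1,2)]
    by (simp add: w_def linear_of_derivation linear_of_xi I_def e_def successive_def)
  have inj: "inj_on w {..<n - 1}" and indep: "map_module.independent (w ` {..<n - 1})"
    unfolding w_def by (rule independent_linear_of[OF \<open>frame I n M v A\<close>]; auto)+
  \<comment> \<open>The frame is indexed from 0, the required family from 1.\<close>
  have shift: "bij_betw (\<lambda>i. i - 1) {1..r} {..<n - 1}"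
    by (rule bij_betw_byWitness[where f' = Suc]) (auto simp: r)
  define \<psi> where "\<psi> i = w (i - 1)" for i
  have "\<psi> ` {1..r} = w ` ((\<lambda>i. i - 1) ` {1..r})"
    by (simp only: \<psi>_def[abs_def] image_image)
  then have image: "\<psi> ` {1..r} = w ` {..<n - 1}"
    by (simp only: bij_betw_imp_surj_on[OF shift])
  have \<psi>_inj: "inj_on \<psi> {1..r}"
    using comp_inj_on[OF bij_betw_imp_inj_on[OF shift]] inj bij_betw_imp_surj_on[OF shift]
    by (simp add: \<psi>_def[abs_def] comp_def)
  have \<psi>_mem: "\<forall>i\<in>{1..r}. \<psi> i \<in> derivations_ab a b"
    using mem by (auto simp: \<psi>_def r)
  have "(\<Prod>i=1..r. deriv_norm (\<psi> i)) = (\<Prod>j<n - 1. deriv_norm (w j))"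
    unfolding \<psi>_def using shift by (rule prod.reindex_bij_betw)
  also have "\<dots> = (\<Prod>j<n - 1. ereal (real (supnorm I (v j))))"
    by (intro prod.cong) (auto simp: w_def deriv_norm_linear_of fin ne b_vecs)
  also have "\<dots> = ereal (real (\<Prod>j<n - 1. supnorm I (v j)))"
    by (simp add: prod_ereal)
  also have "\<dots> \<le> ereal (real_of_int (\<Sum>p\<in>I. \<bar>e p\<bar>))"
  proof -
    have "int (\<Prod>j<n - 1. supnorm I (v j)) \<le> (\<Sum>p\<in>I. \<bar>e p\<bar>)"
      by (rule prod_supnorm_le[where p = p]) (use succ n_def p e(1)[OF p] in auto)
    then have "real_of_int (int (\<Prod>j<n - 1. supnorm I (v j))) \<le> real_of_int (\<Sum>p\<in>I. \<bar>e p\<bar>)"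
      by (simp only: of_int_le_iff)
    then show ?thesis by simp
  qed
  \<comment> \<open>The sum has \<open>n = omega (a * b * c)\<close> terms, each bounded by
    \<open>leibniz_form_supp\<close>.\<close>
  also have "\<dots> \<le> ereal (real n * (c * ln c / (2 * ln 2)))"
    using sum_bounded_above[of I "\<lambda>p. \<bar>real_of_int (e p)\<bar>" "c * ln c / (2 * ln 2)"] e(2)
    by (simp add: n_def)
  finally have "(\<Prod>i=1..r. deriv_norm (\<psi> i))
      \<le> ereal (real (omega (a * b * c)) / (2 * ln 2) * (real_of_int c * ln (real_of_int c)))"
    by (simp add: n_def I_def omega_def)
  moreover have "has_rank (derivations_ab a b) r"
    unfolding has_rank_def
  proof (intro conjI exI allI impI)
    show "w ` {..<n - 1} \<subseteq> derivations_ab a b"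
      using mem by auto
    show "card (w ` {..<n - 1}) = r"
      using inj by (simp add: card_image r)
    show "map_module.independent (w ` {..<n - 1})"
      by (rule indep)
    fix B assume "B \<subseteq> derivations_ab a b" "map_module.independent B"
    then have "finite B \<and> card B \<le> omega (a * b * (a + b)) - 1"
      using assms by (intro independent_derivations_ab) auto
    then show "finite B" "card B \<le> r"
      using assms(4,6) by auto
  qed simp
  ultimately show ?thesis
    using n2 r \<psi>_mem \<psi>_inj indep image by auto
qed

end
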